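(* Let $(W,S)_B$ be an irreducible Coxeter system of level $2$ (it is then Lorentzian), let $\mathscr P=\{\mathrm{Ball}(\omega):\omega\in\Omega_r\}$ be the Boyd--Maxwell ball packing it generates, let $\mathscr C$ be its Coxeter complex, and let $\mathscr G$ be the tangency graph of $\mathscr P$. Then the vertices of $\mathscr G$ are the real vertices of $\mathscr C$ (the ball $\mathrm{Ball}(\omega)$ corresponding to the vertex $\widehat\omega$, for $\omega\in\Omega_r$), and, for two distinct real vertices $u,v$, $uv$ is an edge of $\mathscr G$ if and only if one of the following conditions is fulfilled: - $uv$ is an edge of $\mathscr C$ and it is real, in which case $u$ and $v$ are of different colors; - the vertices $u$ and $v$ are surreal and adjacent, in which case $u$ and $v$ are of the same color.
   Context: **Geometric Coxeter system.** $(W,S)$ is a Coxeter system with $S$ finite, $|S|=n$, with relations $(st)^{m_{st}}=e$ ($m_{ss}=1$, $m_{st}=m_{ts}\in\{2,3,\dots\}\cup\{\infty\}$ for $s\neq t$). $B$ is a symmetric matrix with $B_{st}=-\cos(\pi/m_{st})$ if $m_{st}<\infty$ and $B_{st}=-c_{st}$ if $m_{st}=\infty$, where the reals $c_{st}=c_{ts}\ge 1$ are chosen arbitrarily. $V$ is a real vector space with basis $\Delta=\{\alpha_s\}_{s\in S}$ (simple roots), with symmetric bilinear form $\mathcal B(\alpha_s,\alpha_t)=B_{st}$. $W$ acts faithfully on $V$, preserving $\mathcal B$, by $s\mapsto\sigma_{\alpha_s}$, where $\sigma_\alpha(x)=x-2\frac{\mathcal B(x,\alpha)}{\mathcal B(\alpha,\alpha)}\alpha$.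 The system is *Lorentzian* if $B$ has signature $(n-1,1)$. **Level.** The system is of level $\le r$ if every $(n-r)\times(n-r)$ principal submatrix of $B$ is positive semidefinite, and of level $r$ if it is of level $\le r$ but not of level $\le r-1$ (level $0$: $B$ is positive semidefinite). It is a known result of Maxwell that systems of level $2$ are Lorentzian and that a Lorentzian system generates a ball packing (balls with pairwise disjoint interiors) by the construction below if and only if it is of level $2$. **Weights.** The fundamental weights $\Delta^*=\{\omega_s\}_{s\in S}\subset V$ are defined by $\mathcal B(\alpha_s,\omega_t)=\delta_{st}$, and the set of weights is $\Omega=W(\Delta^* )$. A vector $x$ is space-like if $\mathcal B(x,x)>0$; then $\overline x=x/\sqrt{\mathcal B(x,x)}$. $\Omega_r\subset\Omega$ is the set of space-like weights. **Balls.** For $x\in V\setminus\{0\}$, $\widehat x\in\mathbb PV$ is the line spanned by $x$. $Q=\{x\in V:\mathcal B(x,x)=0\}$, and $\widehat Q\subset\mathbb PV$ is its projectivization. Let $h$ be the sum of coordinates in the basis $\Delta$; if the hyperplane $h=0$ meets $Q$ outside the origin, replace $h$ by a linear form with positive coefficients in the coordinates with respect to $\Delta$ whose kernel meets $Q$ only at $0$. Let $Q^+=\{x\in Q:h(x)>0\}$. For space-like $x$, $\mathrm{Ball}(x)=\{\widehat y:y\in Q^+,\ \mathcal B(x,y)\le 0\}$, a closed ball (spherical cap) in $\widehat Q$. The tangency graph of a ball packing has the balls as vertices, and two distinct balls are joined by an edge if they are tangent (they have disjoint interiors and touch at a boundary point). **Coxeter complex.** Let $C=\mathrm{cone}(\Delta^*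 )$. The Coxeter complex $\mathscr C$ is the simplicial complex whose maximal simplices, called chambers, are $w\cdot\widehat C$, $w\in W$; here $\widehat C$ is a simplex with vertices $\widehat\omega_s$, $s\in S$. Its vertices are the projective weights $\widehat\omega$, $\omega\in\Omega$. A vertex has color $\omega_s\in\Delta^*$ if it lies in the orbit $W\cdot\widehat{\omega_s}$; each vertex has exactly one color, and the vertices of a chamber have distinct colors. A panel is a facet of a chamber; a panel is of type $\omega_s$ if the colors of its vertices are exactly $\Delta^*\setminus\{\omega_s\}$. Two chambers are adjacent if they share a panel. **Real and surreal.** A vertex is *real* if its color is space-like. A vertex of color $\omega\in\Delta^*$ is *surreal* if $\mathcal B(\omega,\omega)=1$, and a panel of type $\omega$ is *surreal* if $\mathcal B(\omega,\omega)=1$. Two (distinct) surreal vertices are *adjacent* if they have the same color and belong to two adjacent chambers of $\mathscr C$ sharing a surreal panel. An edge $uv$ of $\mathscr C$, with $u,v$ of colors $\omega_u,\omega_v$ (both space-like), is *real* if $\mathcal B(\overline{\omega_u},\overline{\omega_v})=-1$. *)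

theory Defs
  imports "HOL-Analysis.Analysis" "HOL-Algebra.Group_Action" "HOL-Algebra.Generated_Groups" "HOL-Library.Extended_Nat"
begin

text \<open>
  The set \<open>S\<close> of generators is a finite type \<open>'s\<close>, so \<open>n = CARD('s)\<close>, and the
  vector space with basis \<open>\<Delta>\<close> is \<open>real^'s\<close>, the simple root \<open>\<alpha>\<^sub>s\<close> being \<open>axis s 1\<close>.
\<close>

definition coxeter_matrix :: "('s \<Rightarrow> 's \<Rightarrow> enat) \<Rightarrow> bool" where
  "coxeter_matrix m \<longleftrightarrow> (\<forall>s. m s s = 1) \<and> (\<forall>s t. m s t = m t s) \<and> (\<forall>s t. s \<noteq> t \<longrightarrow> 2 \<le> m s t)"

text \<open>
  The group presented by the relations \<open>(st)^m\<^sub>s\<^sub>t = e\<close> is encoded through words in \<open>S\<close>.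
  Since \<open>m\<^sub>s\<^sub>s = 1\<close> gives \<open>ss = e\<close>, words without formal inverses suffice.
\<close>

definition coxeter_step :: "('s \<Rightarrow> 's \<Rightarrow> enat) \<Rightarrow> 's list \<Rightarrow> 's list \<Rightarrow> bool" where
  "coxeter_step m xs ys \<longleftrightarrow>
     (\<exists>us vs s t k. m s t = enat k \<and> xs = us @ concat (replicate k [s, t]) @ vs \<and> ys = us @ vs)"

definition word_value :: "('g, 'b) monoid_scheme \<Rightarrow> ('s \<Rightarrow> 'g) \<Rightarrow> 's list \<Rightarrow> 'g" where
  "word_value G gen xs = foldr (mult G) (map gen xs) (one G)"

definition coxeter_system ::
  "('g, 'b) monoid_scheme \<Rightarrow> ('s \<Rightarrow> 'g) \<Rightarrow> ('s \<Rightarrow> 's \<Rightarrow> enat) \<Rightarrow> bool" where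
  "coxeter_system G gen m \<longleftrightarrow>
     coxeter_matrix m \<and> group G \<and> range gen \<subseteq> carrier G \<and>
     generate G (range gen) = carrier G \<and>
     (\<forall>xs ys. word_value G gen xs = word_value G gen ys \<longleftrightarrow> equivclp (coxeter_step m) xs ys)"

text \<open>The Coxeter graph, with an edge \<open>st\<close> whenever \<open>m\<^sub>s\<^sub>t \<ge> 3\<close>, is connected.\<close>

definition irreducible_coxeter :: "('s \<Rightarrow> 's \<Rightarrow> enat) \<Rightarrow> bool" where
  "irreducible_coxeter m \<longleftrightarrow> (\<forall>s t. (\<lambda>a b. a \<noteq> b \<and> 3 \<le> m a b)\<^sup>*\<^sup>* s t)"

definition geometric_matrix :: "('s::finite \<Rightarrow> 's \<Rightarrow> enat) \<Rightarrow> real^'s^'s \<Rightarrow> bool" where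
  "geometric_matrix m B \<longleftrightarrow>
     (\<forall>s t. case m s t of
              enat k \<Rightarrow> B $ s $ t = - cos (pi / real k)
            | \<infinity> \<Rightarrow> B $ s $ t = B $ t $ s \<and> B $ s $ t \<le> -1)"

definition bform :: "real^'s^'s \<Rightarrow> real^'s \<Rightarrow> real^'s \<Rightarrow> real" where
  "bform B x y = x \<bullet> (B *v y)"

definition reflection :: "real^'s^'s \<Rightarrow> real^'s \<Rightarrow> real^'s \<Rightarrow> real^'s" where
  "reflection B a x = x - (2 * bform B x a / bform B a a) *\<^sub>R a"

definition geometric_action ::
  "('g, 'b) monoid_scheme \<Rightarrow> ('s \<Rightarrow> 'g) \<Rightarrow> real^'s^'s \<Rightarrow> ('g \<Rightarrow> real^'s \<Rightarrow> real^'s) \<Rightarrow> bool" where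
  "geometric_action G gen B \<phi> \<longleftrightarrow>
     group_action G UNIV \<phi> \<and> (\<forall>s. \<phi> (gen s) = reflection B (axis s 1))"

definition principal_psd :: "real^'s^'s \<Rightarrow> 's set \<Rightarrow> bool" where
  "principal_psd B I \<longleftrightarrow> (\<forall>x::'s \<Rightarrow> real. 0 \<le> (\<Sum>i\<in>I. \<Sum>j\<in>I. x i * B $ i $ j * x j))"

definition level_le :: "real^'s^'s \<Rightarrow> nat \<Rightarrow> bool" where
  "level_le B r \<longleftrightarrow> (\<forall>I. card I = CARD('s) - r \<longrightarrow> principal_psd B I)"

definition has_level :: "real^'s^'s \<Rightarrow> nat \<Rightarrow> bool" where
  "has_level B r \<longleftrightarrow> level_le B r \<and> (r = 0 \<or> \<not> level_le B (r - 1))"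

subsection \<open>Weights\<close>

text \<open>The description is proper exactly when \<open>B\<close> is nondegenerate.\<close>

definition weight :: "real^'s^'s \<Rightarrow> 's \<Rightarrow> real^'s" where
  "weight B t = (THE x. \<forall>s. bform B (axis s 1) x = (if s = t then 1 else 0))"

definition fundamental_weights :: "real^'s^'s \<Rightarrow> (real^'s) set" where
  "fundamental_weights B = range (weight B)"

definition spacelike :: "real^'s^'s \<Rightarrow> real^'s \<Rightarrow> bool" where
  "spacelike B x \<longleftrightarrow> 0 < bform B x x"

definition normalized :: "real^'s^'s \<Rightarrow> real^'s \<Rightarrow> real^'s" where
  "normalized B x = x /\<^sub>R sqrt (bform B x x)"

definition weights ::
  "('g, 'b) monoid_scheme \<Rightarrow> ('g \<Rightarrow> real^'s \<Rightarrow> real^'s) \<Rightarrow> real^'s^'s \<Rightarrow> (real^'s) set" where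
  "weights G \<phi> B = (\<Union>x\<in>fundamental_weights B. orbit G \<phi> x)"

definition real_weights ::
  "('g, 'b) monoid_scheme \<Rightarrow> ('g \<Rightarrow> real^'s \<Rightarrow> real^'s) \<Rightarrow> real^'s^'s \<Rightarrow> (real^'s) set" where
  "real_weights G \<phi> B = {x \<in> weights G \<phi> B. spacelike B x}"

subsection \<open>Projective space and balls\<close>

definition proj :: "real^'s \<Rightarrow> (real^'s) set" where
  "proj x = span {x}"

definition proj_space :: "(real^'s) set set" where
  "proj_space = proj ` (- {0})"

text \<open>The quotient topology of \<open>proj\<close>, see \<open>openin_proj_topology\<close> below.\<close>

definition proj_topology :: "(real^'s) set topology" where
  "proj_topology = topology (\<lambda>U. U \<subseteq> proj_space \<and> open {x. x \<noteq> 0 \<and> proj x \<in> U})"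

lemma openin_proj_topology:
  "openin proj_topology U \<longleftrightarrow> U \<subseteq> proj_space \<and> open {x::real^'s. x \<noteq> 0 \<and> proj x \<in> U}"
proof -
  have "istopology (\<lambda>U. U \<subseteq> proj_space \<and> open {x::real^'s. x \<noteq> 0 \<and> proj x \<in> U})"
    unfolding istopology_def
  proof (intro conjI allI impI)
    fix U V :: "(real^'s) set set"
    assume U: "U \<subseteq> proj_space \<and> open {x. x \<noteq> 0 \<and> proj x \<in> U}"
      and V: "V \<subseteq> proj_space \<and> open {x. x \<noteq> 0 \<and> proj x \<in> V}"
    then show "U \<inter> V \<subseteq> proj_space" by blast
    have "{x. x \<noteq> 0 \<and> proj x \<in> U \<inter> V} = {x. x \<noteq> 0 \<and> proj x \<in> U} \<inter> {x. x \<noteq> 0 \<and> proj x \<in> V}"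
      by blast
    then show "open {x. x \<noteq> 0 \<and> proj x \<in> U \<inter> V}"
      using U V by (simp add: open_Int)
  next
    fix K :: "(real^'s) set set set"
    assume K: "\<forall>U\<in>K. U \<subseteq> proj_space \<and> open {x. x \<noteq> 0 \<and> proj x \<in> U}"
    then show "\<Union>K \<subseteq> proj_space" by blast
    have "{x. x \<noteq> 0 \<and> proj x \<in> \<Union>K} = (\<Union>U\<in>K. {x. x \<noteq> 0 \<and> proj x \<in> U})"
      by blast
    then show "open {x. x \<noteq> 0 \<and> proj x \<in> \<Union>K}"
      using K by (simp add: open_UN)
  qed
  then show ?thesis
    unfolding proj_topology_def by (simp add: topology_inverse')
qed

definition light_cone :: "real^'s^'s \<Rightarrow> (real^'s) set" where
  "light_cone B = {x. bform B x x = 0}"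

definition light_sphere :: "real^'s^'s \<Rightarrow> (real^'s) set topology" where
  "light_sphere B = subtopology proj_topology (proj ` (light_cone B - {0}))"

text \<open>
  A linear form \<open>h\<close> is given by its coefficient vector \<open>c\<close>, that is \<open>h x = c \<bullet> x\<close>;
  the vector \<open>1\<close> gives the sum of the coordinates.
\<close>

definition avoids_light_cone :: "real^'s^'s \<Rightarrow> real^'s \<Rightarrow> bool" where
  "avoids_light_cone B c \<longleftrightarrow> (\<forall>x\<in>light_cone B. c \<bullet> x = 0 \<longrightarrow> x = 0)"

definition height_form :: "real^'s^'s \<Rightarrow> real^'s \<Rightarrow> bool" where
  "height_form B c \<longleftrightarrow>
     (if avoids_light_cone B 1 then c = 1 else (\<forall>s. 0 < c $ s) \<and> avoids_light_cone B c)"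

definition ball_of :: "real^'s^'s \<Rightarrow> real^'s \<Rightarrow> real^'s \<Rightarrow> (real^'s) set set" where
  "ball_of B c x = proj ` {y \<in> light_cone B. 0 < c \<bullet> y \<and> bform B x y \<le> 0}"

definition ball_packing ::
  "('g, 'b) monoid_scheme \<Rightarrow> ('g \<Rightarrow> real^'s \<Rightarrow> real^'s) \<Rightarrow> real^'s^'s \<Rightarrow> real^'s
     \<Rightarrow> (real^'s) set set set" where
  "ball_packing G \<phi> B c = ball_of B c ` real_weights G \<phi> B"

definition tangent :: "real^'s^'s \<Rightarrow> (real^'s) set set \<Rightarrow> (real^'s) set set \<Rightarrow> bool" where
  "tangent B K L \<longleftrightarrow>
     (light_sphere B interior_of K) \<inter> (light_sphere B interior_of L) = {} \<and>
     (light_sphere B frontier_of K) \<inter> (light_sphere B frontier_of L) \<noteq> {}"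

text \<open>The edge relation of the tangency graph on the vertex set \<open>P\<close>.\<close>

definition tangency_edge ::
  "real^'s^'s \<Rightarrow> (real^'s) set set set \<Rightarrow> (real^'s) set set \<Rightarrow> (real^'s) set set \<Rightarrow> bool" where
  "tangency_edge B P K L \<longleftrightarrow> K \<in> P \<and> L \<in> P \<and> K \<noteq> L \<and> tangent B K L"

subsection \<open>The Coxeter complex\<close>

text \<open>
  A simplex is represented by the set of its vertices, so the chamber of \<open>w\<close>, the simplex
  spanned by the \<open>w\<close>-images of the fundamental weights, is the set of the corresponding lines.
\<close>

definition chambers ::
  "('g, 'b) monoid_scheme \<Rightarrow> ('g \<Rightarrow> real^'s \<Rightarrow> real^'s) \<Rightarrow> real^'s^'s \<Rightarrow> (real^'s) set set set" where
  "chambers G \<phi> B = (\<lambda>w. (\<lambda>x. proj (\<phi> w x)) ` fundamental_weights B) ` carrier G"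

definition coxeter_complex ::
  "('g, 'b) monoid_scheme \<Rightarrow> ('g \<Rightarrow> real^'s \<Rightarrow> real^'s) \<Rightarrow> real^'s^'s \<Rightarrow> (real^'s) set set set" where
  "coxeter_complex G \<phi> B = {F. F \<noteq> {} \<and> (\<exists>D\<in>chambers G \<phi> B. F \<subseteq> D)}"

definition vertices ::
  "('g, 'b) monoid_scheme \<Rightarrow> ('g \<Rightarrow> real^'s \<Rightarrow> real^'s) \<Rightarrow> real^'s^'s \<Rightarrow> (real^'s) set set" where
  "vertices G \<phi> B = {v. {v} \<in> coxeter_complex G \<phi> B}"

definition complex_edge ::
  "('g, 'b) monoid_scheme \<Rightarrow> ('g \<Rightarrow> real^'s \<Rightarrow> real^'s) \<Rightarrow> real^'s^'s
     \<Rightarrow> (real^'s) set \<Rightarrow> (real^'s) set \<Rightarrow> bool" where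
  "complex_edge G \<phi> B u v \<longleftrightarrow> u \<noteq> v \<and> {u, v} \<in> coxeter_complex G \<phi> B"

definition color ::
  "('g, 'b) monoid_scheme \<Rightarrow> ('g \<Rightarrow> real^'s \<Rightarrow> real^'s) \<Rightarrow> real^'s^'s \<Rightarrow> (real^'s) set \<Rightarrow> real^'s" where
  "color G \<phi> B v = (THE x. x \<in> fundamental_weights B \<and> v \<in> proj ` orbit G \<phi> x)"

definition panel_of :: "'v set \<Rightarrow> 'v set \<Rightarrow> bool" where
  "panel_of F D \<longleftrightarrow> (\<exists>v\<in>D. F = D - {v})"

definition panel_type ::
  "('g, 'b) monoid_scheme \<Rightarrow> ('g \<Rightarrow> real^'s \<Rightarrow> real^'s) \<Rightarrow> real^'s^'s
     \<Rightarrow> (real^'s) set set \<Rightarrow> real^'s \<Rightarrow> bool" where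
  "panel_type G \<phi> B F x \<longleftrightarrow>
     x \<in> fundamental_weights B \<and> color G \<phi> B ` F = fundamental_weights B - {x}"

definition surreal_panel ::
  "('g, 'b) monoid_scheme \<Rightarrow> ('g \<Rightarrow> real^'s \<Rightarrow> real^'s) \<Rightarrow> real^'s^'s \<Rightarrow> (real^'s) set set \<Rightarrow> bool" where
  "surreal_panel G \<phi> B F \<longleftrightarrow> (\<exists>x. panel_type G \<phi> B F x \<and> bform B x x = 1)"

definition real_vertices ::
  "('g, 'b) monoid_scheme \<Rightarrow> ('g \<Rightarrow> real^'s \<Rightarrow> real^'s) \<Rightarrow> real^'s^'s \<Rightarrow> (real^'s) set set" where
  "real_vertices G \<phi> B = {v \<in> vertices G \<phi> B. spacelike B (color G \<phi> B v)}"

definition surreal_vertices ::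
  "('g, 'b) monoid_scheme \<Rightarrow> ('g \<Rightarrow> real^'s \<Rightarrow> real^'s) \<Rightarrow> real^'s^'s \<Rightarrow> (real^'s) set set" where
  "surreal_vertices G \<phi> B =
     {v \<in> vertices G \<phi> B. bform B (color G \<phi> B v) (color G \<phi> B v) = 1}"

definition real_edge ::
  "('g, 'b) monoid_scheme \<Rightarrow> ('g \<Rightarrow> real^'s \<Rightarrow> real^'s) \<Rightarrow> real^'s^'s
     \<Rightarrow> (real^'s) set \<Rightarrow> (real^'s) set \<Rightarrow> bool" where
  "real_edge G \<phi> B u v \<longleftrightarrow>
     complex_edge G \<phi> B u v \<and> spacelike B (color G \<phi> B u) \<and> spacelike B (color G \<phi> B v) \<and>
     bform B (normalized B (color G \<phi> B u)) (normalized B (color G \<phi> B v)) = -1"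

definition surreal_adjacent ::
  "('g, 'b) monoid_scheme \<Rightarrow> ('g \<Rightarrow> real^'s \<Rightarrow> real^'s) \<Rightarrow> real^'s^'s
     \<Rightarrow> (real^'s) set \<Rightarrow> (real^'s) set \<Rightarrow> bool" where
  "surreal_adjacent G \<phi> B u v \<longleftrightarrow>
     u \<in> surreal_vertices G \<phi> B \<and> v \<in> surreal_vertices G \<phi> B \<and> u \<noteq> v \<and>
     color G \<phi> B u = color G \<phi> B v \<and>
     (\<exists>D\<in>chambers G \<phi> B. \<exists>E\<in>chambers G \<phi> B. \<exists>F. u \<in> D \<and> v \<in> E \<and> D \<noteq> E \<and>
        panel_of F D \<and> panel_of F E \<and> surreal_panel G \<phi> B F)"

end

(*
  Idea. The product of two weights is a coordinate of a weight in the orbit of a fundamental weight.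
  Applying a reduced word to a fundamental weight only subtracts positive multiples of positive roots,
  so this coordinate is largest on a common chamber (different colors) or, for equal colors, when the
  word is a single generator s, where it equals B(w_s,w_s) - 2; minimality in the double coset of
  parabolic subgroups makes all other cases strictly smaller. Level two bounds these extremal values:
  the form is Lorentzian, real fundamental weights satisfy B(w_s,w_s) <= 1 and
  B(w_s,w_t) <= -sqrt(B(w_s,w_s) B(w_t,w_t)). Hence two distinct real weights have normalized product at
  most -1, with equality exactly for real edges and surreal adjacencies; by Lorentzian geometry,
  equality means that the balls touch, and otherwise they are disjoint.
*)
theory Submission
  imports Defs
begin

section \<open>Forms of level two\<close>

text \<open>Level at most two enters as one fact: a vector with two zero coordinates has nonnegative
  norm. The signature, the signs of the weights and their Gram determinants all come from building
  such a vector whose norm would otherwise be negative. A Perron eigenvector with positive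
  coordinates serves as time direction; its negative lies in the chamber cut out by the simple
  roots, so it pairs positively with every weight. The delicate point is equality. Weak monotonicity
  along reduced words only gives a packing; recognizing tangency needs a strict drop, and a positive
  root may have coordinate zero at the relevant color. Passing to a shortest double coset
  representative rules this out for the last root.\<close>

locale coxeter_form =
  fixes B :: "real^'s::finite^'s"
  assumes diag: "B $ s $ s = 1"
    and symm: "B $ s $ t = B $ t $ s"
    and nonpos: "s \<noteq> t \<Longrightarrow> B $ s $ t \<le> 0"
begin

abbreviation bf :: "real^'s \<Rightarrow> real^'s \<Rightarrow> real" where "bf \<equiv> bform B"

abbreviation \<alpha> :: "'s \<Rightarrow> real^'s" where "\<alpha> s \<equiv> axis s 1"

lemma bf_sum: "bf x y = (\<Sum>i\<in>UNIV. \<Sum>j\<in>UNIV. x$i * B$i$j * y$j)"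
  by (simp add: bform_def inner_vec_def matrix_vector_mult_def sum_distrib_left mult.assoc)

lemma bf_commute: "bf x y = bf y x"
proof -
  have "bf x y = (\<Sum>j\<in>UNIV. \<Sum>i\<in>UNIV. x$i * B$i$j * y$j)"
    unfolding bf_sum by (rule sum.swap)
  also have "\<dots> = bf y x"
    unfolding bf_sum by (intro sum.cong refl) (metis symm mult.commute mult.left_commute)
  finally show ?thesis .
qed

lemma bilinear_bf: "bilinear bf"
  unfolding bilinear_def bform_def
  by (auto intro!: linearI simp: inner_add_left inner_add_right matrix_vector_right_distrib
      matrix_vector_mult_scaleR)

lemmas bf_simps =
  bilinear_ladd[OF bilinear_bf] bilinear_radd[OF bilinear_bf]
  bilinear_lsub[OF bilinear_bf] bilinear_rsub[OF bilinear_bf]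
  bilinear_lmul[OF bilinear_bf] bilinear_rmul[OF bilinear_bf]
  bilinear_lneg[OF bilinear_bf] bilinear_rneg[OF bilinear_bf]
  bilinear_lzero[OF bilinear_bf] bilinear_rzero[OF bilinear_bf]

lemma bf_root: "bf (\<alpha> s) x = (B *v x) $ s"
  by (simp add: bform_def inner_axis')

lemma bf_root_root: "bf (\<alpha> s) (\<alpha> t) = B $ s $ t"
  by (simp add: bf_root matrix_vector_mult_basis column_def)

lemma bf_expand: "bf x y = (\<Sum>i\<in>UNIV. x$i * bf (\<alpha> i) y)"
  by (simp add: bf_root) (simp add: bform_def inner_vec_def)

lemma continuous_bf [continuous_intros]:
  fixes f g :: "'a::euclidean_space \<Rightarrow> real^'s"
  shows "continuous_on S f \<Longrightarrow> continuous_on S g \<Longrightarrow> continuous_on S (\<lambda>x. bf (f x) (g x))"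
  unfolding bform_def
  by (intro continuous_intros linear_continuous_on_compose[of S g "(*v) B"] matrix_vector_mul_linear)

text \<open>Along \<open>q + e *\<^sub>R x\<close> the shifted form is linear plus quadratic in
  \<open>e\<close>; it stays nonnegative for small \<open>e\<close> of both signs only if the linear
  coefficient vanishes. This is the Lagrange condition that turns a minimizer into an
  eigenvector.\<close>

lemma bf_psd_kernel:
  assumes V: "subspace V" and psd: "\<And>x. x \<in> V \<Longrightarrow> 0 \<le> bf x x + k * (x \<bullet> x)"
    and q: "q \<in> V" "bf q q + k * (q \<bullet> q) = 0" and x: "x \<in> V"
  shows "bf q x + k * (q \<bullet> x) = 0"
proof -
  define b where "b = bf q x + k * (q \<bullet> x)"
  define c where "c = bf x x + k * (x \<bullet> x)"
  have c: "c \<ge> 0" using psd[OF x] by (simp add: c_def)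
  have exp: "bf (q + e *\<^sub>R x) (q + e *\<^sub>R x) + k * ((q + e *\<^sub>R x) \<bullet> (q + e *\<^sub>R x))
      = 2 * e * b + e\<^sup>2 * c" for e
    using q(2) by (simp add: bf_simps b_def c_def bf_commute[of x q] inner_simps inner_commute[of x q]
        power2_eq_square algebra_simps)
  have ge: "0 \<le> 2 * e * b + e\<^sup>2 * c" for e
    using psd[of "q + e *\<^sub>R x"] V q x unfolding exp
    by (simp add: subspace_add subspace_scale)
  \<comment> \<open>From here on \<open>k\<close> is a step size: the added 1 covers
    \<open>c = 0\<close>, and \<open>k * c \<le> 1\<close> keeps \<open>k * c - 2\<close>
    negative.\<close>
  define k where "k = 1 / (c+1)"
  have k: "k > 0" "k * c \<le> 1" using c by (simp_all add: k_def field_simps)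
  have "0 \<le> k * b\<^sup>2 * (k * c - 2)"
    using ge[of "- k * b"] by (simp add: algebra_simps power2_eq_square)
  then have "b\<^sup>2 \<le> 0"
  proof -
    have "k * b\<^sup>2 \<le> 0"
    proof (rule ccontr)
      assume "\<not> k * b\<^sup>2 \<le> 0"
      then have "k * b\<^sup>2 * (k * c - 2) < 0" using k by (intro mult_pos_neg) auto
      then show False using \<open>0 \<le> k * b\<^sup>2 * (k * c - 2)\<close> by simp
    qed
    then show ?thesis using k by (simp add: mult_le_0_iff)
  qed
  then have "b = 0" by simp
  then show ?thesis by (simp add: b_def)
qed

lemma bf_nonneg_disjoint:
  assumes "\<And>i. 0 \<le> x$i" "\<And>i. 0 \<le> y$i" "\<And>i. x$i = 0 \<or> y$i = 0"
  shows "bf x y \<le> 0"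
  unfolding bf_sum
proof (intro sum_nonpos)
  fix i j
  show "x$i * B$i$j * y$j \<le> 0"
  proof (cases "i = j")
    case True then show ?thesis using assms(3)[of i] by auto
  next
    case False
    have "x$i * y$j * B$i$j \<le> 0"
      using nonpos[OF False] assms by (intro mult_nonneg_nonpos mult_nonneg_nonneg) auto
    then show ?thesis by (simp add: mult_ac)
  qed
qed

section \<open>Positive and negative parts; Perron vectors\<close>

definition pos_part :: "real^'s \<Rightarrow> real^'s" where "pos_part x = (\<chi> i. max (x$i) 0)"

lemma pos_part_nth [simp]: "pos_part x $ i = max (x$i) 0"
  by (simp add: pos_part_def)

lemma pos_part_diff: "x = pos_part x - pos_part (- x)"
  by (auto simp: vec_eq_iff max_def)

lemma bf_pos_part: "bf (pos_part x) (pos_part (- x)) \<le> 0"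
  by (rule bf_nonneg_disjoint) auto

text \<open>Together with \<open>bf_pos_part\<close>, the norm of a vector is at least the sum of
  the norms of its two parts.\<close>

lemma bf_split:
  "bf x x = bf (pos_part x) (pos_part x) + bf (pos_part (- x)) (pos_part (- x))
     - 2 * bf (pos_part x) (pos_part (- x))"
proof -
  have "bf (u - v) (u - v) = bf u u + bf v v - 2 * bf u v" for u v
    by (simp add: bf_simps bf_commute[of v u])
  from this[of "pos_part x" "pos_part (- x)"] show ?thesis
    by (simp flip: pos_part_diff)
qed

text \<open>
  Minimize the form on the unit sphere of the coordinate subspace of \<open>T\<close>: as \<open>B\<close> is nonpositive off the
  diagonal, the coordinatewise absolute value of a minimizer is again a minimizer.
\<close>

lemma perron_vector:
  assumes x0: "bf x0 x0 < 0" "\<And>i. i \<notin> T \<Longrightarrow> x0 $ i = 0"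
  shows "\<exists>q \<mu>. \<mu> > 0 \<and> q \<noteq> 0 \<and> (\<forall>i. 0 \<le> q$i) \<and> (\<forall>i. i \<notin> T \<longrightarrow> q$i = 0) \<and>
    (\<forall>i\<in>T. bf (\<alpha> i) q = - \<mu> * q$i)"
proof -
  define V where "V = {x::real^'s. \<forall>i. i \<notin> T \<longrightarrow> x$i = 0}"
  have V: "subspace V" by (auto simp: V_def subspace_def)
  have "closed V" by (rule closed_subspace[OF V])
  then have comp: "compact (V \<inter> sphere 0 1)"
    by (simp add: closed_Int_compact)
  have x0n: "x0 \<noteq> 0" using x0 by (auto simp: bf_simps)
  have x0V: "x0 \<in> V" using x0 by (auto simp: V_def)
  have "x0 /\<^sub>R norm x0 \<in> V \<inter> sphere 0 1"
    using V x0V x0n by (simp add: subspace_scale)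
  then obtain q0 where q0: "q0 \<in> V" "norm q0 = 1"
    and min: "\<And>x. x \<in> V \<Longrightarrow> norm x = 1 \<Longrightarrow> bf q0 q0 \<le> bf x x"
    using continuous_attains_inf[OF comp _ continuous_bf[OF continuous_on_id continuous_on_id]]
    by fastforce
  define \<mu> where "\<mu> = - bf q0 q0"
  have psd: "0 \<le> bf x x + \<mu> * (x \<bullet> x)" if x: "x \<in> V" for x
  proof (cases "x = 0")
    case True then show ?thesis by (simp add: bf_simps)
  next
    case False
    have "x /\<^sub>R norm x \<in> V" using V x by (simp add: subspace_scale)
    from min[OF this] have "- \<mu> \<le> bf x x / (norm x)\<^sup>2"
      using False by (simp add: \<mu>_def bf_simps power2_eq_square divide_inverse mult_ac)
    then show ?thesis using False
      by (simp add: field_simps power2_norm_eq_inner)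
  qed
  have \<mu>: "\<mu> > 0"
  proof (rule ccontr)
    assume "\<not> \<mu> > 0"
    then have "\<mu> * (x0 \<bullet> x0) \<le> 0" by (intro mult_nonpos_nonneg) auto
    then show False using psd[OF x0V] x0(1) by linarith
  qed
  define q where "q = pos_part q0 + pos_part (- q0)"
  have qV: "q \<in> V" using q0 by (auto simp: V_def q_def)
  have qabs: "q $ i = \<bar>q0 $ i\<bar>" for i by (simp add: q_def)
  have qq: "q \<bullet> q = 1"
    using q0(2) by (simp add: inner_vec_def qabs norm_eq_1)
  have "bf q q \<le> bf q0 q0"
    using bf_pos_part[of q0] unfolding bf_split[of q0] q_def
    by (simp add: bf_simps bf_commute[of "pos_part (-q0)" "pos_part q0"])
  then have "bf q q + \<mu> * (q \<bullet> q) = 0"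
    using psd[OF qV] by (simp add: \<mu>_def qq)
  from bf_psd_kernel[OF V psd qV this] have ker: "\<And>x. x \<in> V \<Longrightarrow> bf q x + \<mu> * (q \<bullet> x) = 0" .
  show ?thesis
  proof (intro exI conjI allI ballI impI)
    show "\<mu> > 0" by fact
    show "q \<noteq> 0" using qq by auto
    show "0 \<le> q$i" for i by (simp add: qabs)
    show "q $ i = 0" if "i \<notin> T" for i using qV that by (simp add: V_def)
    show "bf (\<alpha> i) q = - \<mu> * q $ i" if "i \<in> T" for i
    proof -
      have "\<alpha> i \<in> V" using that by (auto simp: V_def axis_def)
      from ker[OF this] show ?thesis by (simp add: bf_commute inner_axis)
    qed
  qed
qed

end

section \<open>Lorentzian signature of forms of level two\<close>

locale level_two_form = coxeter_form B for B :: "real^'s::finite^'s" +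
  assumes not_psd: "\<exists>x. bf x x < 0"
    and codim_two_psd: "s \<noteq> t \<Longrightarrow> x$s = 0 \<Longrightarrow> x$t = 0 \<Longrightarrow> 0 \<le> bf x x"
    and connected: "(\<lambda>a b. B$a$b < 0)\<^sup>*\<^sup>* s t"
    and rank_ge_3: "3 \<le> CARD('s)"
begin

lemma third_index:
  fixes s t :: 's
  obtains r where "r \<noteq> s" "r \<noteq> t"
proof -
  have "card {s,t} \<le> 2" by (simp add: card_insert_if)
  then have "card {s,t} \<noteq> CARD('s)" using rank_ge_3 by linarith
  then have "{s,t} \<noteq> UNIV" by (rule contrapos_nn) (rule arg_cong)
  then obtain r where "r \<notin> {s,t}" by blast
  then show ?thesis using that[of r] by blast
qed

text \<open>In the row of a vanishing coordinate all terms are nonpositive and sum to zero, so every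
  neighbor in the Coxeter graph vanishes too; connectedness would then make the whole vector
  zero.\<close>

lemma perron_ex: "\<exists>p \<mu>. \<mu> > 0 \<and> (\<forall>i. 0 < p$i) \<and> (\<forall>i. bf (\<alpha> i) p = - \<mu> * p$i)"
proof -
  obtain x0 where "bf x0 x0 < 0" using not_psd by blast
  then obtain q \<mu> where q: "\<mu> > 0" "q \<noteq> 0" "\<And>i. 0 \<le> q$i" "\<And>i. bf (\<alpha> i) q = - \<mu> * q $ i"
    using perron_vector[of x0 UNIV] by blast
  have step: "q$b = 0" if "q$a = 0" "B$a$b < 0" for a b
  proof -
    have "0 = bf (\<alpha> a) q" using q(4)[of a] that by simp
    also have "\<dots> = (\<Sum>j\<in>UNIV. B$a$j * q$j)"
      by (simp add: bf_root matrix_vector_mult_def)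
    finally have "(\<Sum>j\<in>UNIV. - (B$a$j * q$j)) = 0" by (simp add: sum_negf)
    moreover have "0 \<le> - (B$a$j * q$j)" for j
      using nonpos[of a j] q(3)[of j] that by (cases "j = a") (auto simp: mult_nonpos_nonneg)
    ultimately have "- (B$a$b * q$b) = 0" by (simp add: sum_nonneg_eq_0_iff)
    then show ?thesis using that by simp
  qed
  have "q$i > 0" for i
  proof (rule ccontr)
    assume "\<not> q$i > 0"
    then have 0: "q$i = 0" using q(3)[of i] by simp
    have "q$j = 0" for j
      using connected[of i j] by (induction) (use 0 step in auto)
    then show False using q(2) by (simp add: vec_eq_iff)
  qed
  then show ?thesis using q by blast
qed

text \<open>A Perron-Frobenius eigenvector of \<open>B\<close>, for a negative eigenvalue; one is
  fixed as the time direction.\<close>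

definition perron :: "real^'s" where
  "perron = (SOME p. \<exists>\<mu>>0. (\<forall>i. 0 < p$i) \<and> (\<forall>i. bf (\<alpha> i) p = - \<mu> * p$i))"

definition perron_value :: real where
  "perron_value = (SOME \<mu>. \<mu> > 0 \<and> (\<forall>i. bf (\<alpha> i) perron = - \<mu> * perron$i))"

lemma perron_aux: "\<exists>\<mu>>0. (\<forall>i. 0 < perron$i) \<and> (\<forall>i. bf (\<alpha> i) perron = - \<mu> * perron$i)"
  unfolding perron_def by (rule someI_ex) (use perron_ex in blast)

lemma perron_pos: "0 < perron$i"
  using perron_aux by blast

lemma perron_value: "0 < perron_value" "bf (\<alpha> i) perron = - perron_value * perron$i"
proof -
  have "\<exists>\<mu>. \<mu> > 0 \<and> (\<forall>i. bf (\<alpha> i) perron = - \<mu> * perron$i)" using perron_aux by blast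
  from someI_ex[OF this] show "0 < perron_value" "bf (\<alpha> i) perron = - perron_value * perron$i"
    unfolding perron_value_def by blast+
qed

text \<open>Because of this, the hyperplanes orthogonal to \<open>perron\<close> for the form and
  for the inner product coincide, and \<open>x \<bullet> perron\<close> measures time.\<close>

lemma bf_perron: "bf x perron = - perron_value * (x \<bullet> perron)"
proof -
  have "bf x perron = (\<Sum>i\<in>UNIV. x$i * (- perron_value * perron$i))"
    by (subst bf_expand) (simp only: perron_value(2))
  also have "\<dots> = (\<Sum>i\<in>UNIV. - perron_value * (x$i * perron$i))"
    by (intro sum.cong refl) simp
  also have "\<dots> = - perron_value * (x \<bullet> perron)"
    by (simp only: sum_distrib_left[symmetric]) (simp add: inner_vec_def)
  finally show ?thesis .
qed

lemma bf_perron': "bf perron x = - perron_value * (x \<bullet> perron)"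
  by (simp add: bf_commute[of perron] bf_perron)

lemma perron_nonzero: "perron \<noteq> 0"
  using perron_pos[of undefined] by auto

lemma perron_timelike: "bf perron perron < 0"
  unfolding bf_perron using perron_value perron_nonzero by simp

text \<open>The positive part vanishes at \<open>r\<close> and \<open>b\<close>, the negative part
  at \<open>r\<close> and \<open>a\<close>, so both have nonnegative norm. The equality clause
  serves the degenerate case where the whole vector is null.\<close>

lemma mixed_sign_psd:
  assumes r: "y$r = 0" and a: "y$a > 0" and b: "y$b < 0"
  shows "0 \<le> bf y y" and "bf y y = 0 \<Longrightarrow> bf (pos_part y) (pos_part y) = 0"
proof -
  have "0 \<le> bf (pos_part y) (pos_part y)"
    using codim_two_psd[of r b "pos_part y"] assms by force
  moreover have "0 \<le> bf (pos_part (-y)) (pos_part (-y))"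
    using codim_two_psd[of r a "pos_part (-y)"] assms by force
  ultimately show "0 \<le> bf y y" and "bf y y = 0 \<Longrightarrow> bf (pos_part y) (pos_part y) = 0"
    using bf_pos_part[of y] bf_split[of y] by auto
qed

text \<open>
  Level two forces signature \<open>(n-1,1)\<close>. Otherwise the form is nonpositive on a plane containing the
  positive vector \<open>perron\<close>, and a vector of this plane with one zero coordinate and coordinates of both
  signs splits into two parts, each with two zero coordinates.
\<close>

lemma pos_def_perp:
  assumes xp: "x \<bullet> perron = 0" and x0: "x \<noteq> 0"
  shows "0 < bf x x"
proof (rule ccontr)
  assume "\<not> 0 < bf x x"
  then have xx: "bf x x \<le> 0" by simp
  \<comment> \<open>Subtracting \<open>k *\<^sub>R perron\<close> shifts all ratios by
    \<open>k\<close>, so \<open>k = \<rho> r\<close> kills coordinate \<open>r\<close> and leaves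
    signs given by the order of the ratios.\<close>
  define \<rho> where "\<rho> i = x$i / perron$i" for i
  have x\<rho>: "x$i = \<rho> i * perron$i" for i using perron_pos[of i] by (simp add: \<rho>_def)
  have yy: "bf (x - k *\<^sub>R perron) (x - k *\<^sub>R perron) = bf x x + k\<^sup>2 * bf perron perron" for k
    using xp by (simp add: bf_simps bf_perron[of x] bf_perron'[of x] power2_eq_square)
  have yneg: "bf (x - k *\<^sub>R perron) (x - k *\<^sub>R perron) < 0" if "k \<noteq> 0" for k
    using that xx perron_timelike yy by (smt (verit) mult_pos_neg zero_less_power2)
  have ynth: "(x - k *\<^sub>R perron) $ i = (\<rho> i - k) * perron $ i" for k i
    by (simp add: x\<rho> algebra_simps)
  have "Max (range \<rho>) \<in> range \<rho>" by (intro Max_in) auto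
  then obtain s where s: "\<And>i. \<rho> i \<le> \<rho> s" by (metis Max_ge finite finite_imageI imageE rangeI)
  have "Min (range \<rho>) \<in> range \<rho>" by (intro Min_in) auto
  then obtain t where t: "\<And>i. \<rho> t \<le> \<rho> i" by (metis Min_le finite finite_imageI imageE rangeI)
  have sum0: "(\<Sum>i\<in>UNIV. \<rho> i * (perron$i)\<^sup>2) = 0"
    using xp by (simp add: inner_vec_def x\<rho> power2_eq_square mult_ac)
  have nz: "\<exists>i. \<rho> i \<noteq> 0" using x0 x\<rho> by (auto simp: vec_eq_iff)
  have ps: "\<rho> s > 0"
  proof (rule ccontr)
    assume "\<not> \<rho> s > 0"
    then have le: "\<rho> i \<le> 0" for i using s[of i] by linarith
    have "(\<Sum>i\<in>UNIV. - (\<rho> i * (perron$i)\<^sup>2)) = 0" using sum0 by (simp add: sum_negf)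
    moreover have "0 \<le> - (\<rho> i * (perron$i)\<^sup>2)" for i using le[of i] by (simp add: mult_nonpos_nonneg)
    ultimately have "\<rho> i * (perron$i)\<^sup>2 = 0" for i
      by (simp add: sum_nonneg_eq_0_iff)
    then show False using nz perron_pos by (metis less_irrefl mult_eq_0_iff zero_eq_power2)
  qed
  have pt: "\<rho> t < 0"
  proof (rule ccontr)
    assume "\<not> \<rho> t < 0"
    then have le: "0 \<le> \<rho> i" for i using t[of i] by linarith
    have "0 \<le> \<rho> i * (perron$i)\<^sup>2" for i using le[of i] by simp
    then have "\<rho> i * (perron$i)\<^sup>2 = 0" for i
      using sum0 by (simp add: sum_nonneg_eq_0_iff)
    then show False using nz perron_pos by (metis less_irrefl mult_eq_0_iff zero_eq_power2)
  qed
  have mid: "\<rho> r = 0 \<and> bf x x = 0 \<and> bf (pos_part x) (pos_part x) = 0" if r: "r \<noteq> s" "r \<noteq> t" for r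
  proof -
    have 1: "\<rho> r \<noteq> \<rho> s"
    proof
      assume "\<rho> r = \<rho> s"
      then have "0 \<le> bf (x - \<rho> s *\<^sub>R perron) (x - \<rho> s *\<^sub>R perron)"
        using ynth by (intro codim_two_psd[OF r(1)]) auto
      then show False using yneg[of "\<rho> s"] ps by simp
    qed
    have 2: "\<rho> r \<noteq> \<rho> t"
    proof
      assume "\<rho> r = \<rho> t"
      then have "0 \<le> bf (x - \<rho> t *\<^sub>R perron) (x - \<rho> t *\<^sub>R perron)"
        using ynth by (intro codim_two_psd[OF r(2)]) auto
      then show False using yneg[of "\<rho> t"] pt by simp
    qed
    have lt: "\<rho> t < \<rho> r" "\<rho> r < \<rho> s" using s[of r] t[of r] 1 2 by auto
    let ?y = "x - \<rho> r *\<^sub>R perron"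
    have y: "?y$r = 0" "?y$s > 0" "?y$t < 0"
      unfolding ynth using lt perron_pos by (auto intro: mult_neg_pos)
    note m = mixed_sign_psd[OF y]
    have z: "\<rho> r = 0" using m(1) yneg[of "\<rho> r"] by fastforce
    then show ?thesis using m xx by auto
  qed
  \<comment> \<open>What remains is an \<open>x\<close> supported on \<open>s\<close> and
    \<open>t\<close>. The third index is used to learn that its positive part is null, although that
    part is a nonzero multiple of \<open>\<alpha> s\<close>, which has norm 1.\<close>
  obtain r where "r \<noteq> s" "r \<noteq> t" by (rule third_index)
  from mid[OF this] have 0: "bf (pos_part x) (pos_part x) = 0" by blast
  have "pos_part x = x$s *\<^sub>R \<alpha> s"
  proof (subst vec_eq_iff, rule)
    fix i
    consider "i = s" | "i = t" "i \<noteq> s" | "i \<noteq> s" "i \<noteq> t" by blast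
    then show "pos_part x $ i = (x$s *\<^sub>R \<alpha> s) $ i"
    proof cases
      case 1 then show ?thesis using ps perron_pos[of s] by (simp add: x\<rho>)
    next
      case 2 then show ?thesis using pt perron_pos[of t] by (simp add: x\<rho> axis_def mult_nonpos_nonneg)
    next
      case 3 then show ?thesis using mid[of i] by (simp add: x\<rho> axis_def)
    qed
  qed
  then have "(x$s)\<^sup>2 = 0" using 0 by (simp add: bf_simps bf_root_root diag power2_eq_square)
  then show False using ps perron_pos[of s] by (simp add: x\<rho>)
qed

text \<open>The factor \<open>k\<close> brings \<open>b\<close> to the same time as
  \<open>a\<close>, so \<open>a - k *\<^sub>R b\<close> is perpendicular to \<open>perron\<close>
  and has nonnegative norm; expanding this norm gives both claims.\<close>

lemma causal_opposite:
  assumes "bf a a \<le> 0" "bf b b \<le> 0" "0 < a \<bullet> perron" "0 < b \<bullet> perron"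
  shows "bf a b \<le> 0" and "bf a b = 0 \<Longrightarrow> bf a a = 0"
proof -
  define k where "k = (a \<bullet> perron) / (b \<bullet> perron)"
  have k: "k > 0" using assms by (simp add: k_def)
  have perp: "(a - k *\<^sub>R b) \<bullet> perron = 0" using assms by (simp add: k_def inner_simps)
  have exp: "bf (a - k *\<^sub>R b) (a - k *\<^sub>R b) = bf a a - 2 * k * bf a b + k\<^sup>2 * bf b b"
    by (simp add: bf_simps bf_commute[of b a] power2_eq_square algebra_simps)
  have ge: "0 \<le> bf (a - k *\<^sub>R b) (a - k *\<^sub>R b)"
    using pos_def_perp[OF perp] by (cases "a - k *\<^sub>R b = 0") (auto simp: bf_simps)
  have k2: "k\<^sup>2 * bf b b \<le> 0" using assms by (simp add: mult_nonneg_nonpos)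
  have "2 * (k * bf a b) \<le> 0" using ge exp k2 assms(1) by auto
  then have "k * bf a b \<le> 0" by simp
  then show "bf a b \<le> 0" using k by (simp add: mult_le_0_iff)
  show "bf a a = 0" if "bf a b = 0"
    using ge exp k2 assms(1) that by auto
qed

text \<open>A vector in the radical is perpendicular to \<open>perron\<close> and null. This is what
  makes the description of \<open>weight\<close> proper.\<close>

lemma nondegenerate:
  assumes "\<And>s. bf (\<alpha> s) x = 0" shows "x = 0"
proof (rule ccontr)
  assume "x \<noteq> 0"
  have z: "bf y x = 0" for y by (subst bf_expand) (simp add: assms)
  have "x \<bullet> perron = 0" using z[of perron] perron_value by (simp add: bf_perron')
  from pos_def_perp[OF this \<open>x \<noteq> 0\<close>] show False using z by simp
qed

section \<open>Fundamental weights and bounds on their Gram matrix\<close>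

abbreviation \<omega> :: "'s \<Rightarrow> real^'s" where "\<omega> \<equiv> weight B"

lemma bf_root_weight: "bf (\<alpha> s) (\<omega> t) = (if s = t then 1 else 0)"
proof -
  have "inj ((*v) B)"
    using nondegenerate by (auto simp: linear_injective_0 matrix_vector_mul_linear bf_root vec_eq_iff)
  then have "surj ((*v) B)"
    using linear_injective_imp_surjective matrix_vector_mul_linear by blast
  then obtain x where "B *v x = \<alpha> t" by (metis surjD)
  then have x: "\<forall>s. bf (\<alpha> s) x = (if s = t then 1 else 0)"
    by (simp only: bf_root) (auto simp: axis_def)
  have "\<forall>s. bf (\<alpha> s) (\<omega> t) = (if s = t then 1 else 0)"
    unfolding weight_def
  proof (rule theI[of _ x])
    show "\<forall>s. bf (\<alpha> s) x = (if s = t then 1 else 0)" by (rule x)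
    fix y assume y: "\<forall>s. bf (\<alpha> s) y = (if s = t then 1 else 0)"
    have "y - x = 0" by (rule nondegenerate) (use x y in \<open>simp add: bf_simps\<close>)
    then show "y = x" by simp
  qed
  then show ?thesis by blast
qed

lemma bf_weight: "bf x (\<omega> t) = x$t" "bf (\<omega> t) x = x$t"
proof -
  show "bf x (\<omega> t) = x$t"
    by (subst bf_expand) (simp add: bf_root_weight if_distrib cong: if_cong)
  then show "bf (\<omega> t) x = x$t" by (simp add: bf_commute)
qed

lemma inj_weight: "inj \<omega>"
proof (rule injI)
  fix s t assume "\<omega> s = \<omega> t"
  then show "s = t" using bf_root_weight[of s s] bf_root_weight[of s t] by (simp split: if_splits)
qed

lemma weight_sym: "\<omega> s $ t = \<omega> t $ s"
  using bf_weight(1)[of "\<omega> s" t] bf_weight(2)[of s "\<omega> t"] by simp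

text \<open>Pairing with \<open>\<omega> s\<close> reads off coordinate \<open>s\<close>, so the
  projection of \<open>perron\<close> along \<open>\<omega> s\<close> loses this coordinate;
  removing a spacelike component keeps it timelike.\<close>

lemma real_weight_complement:
  assumes "0 < \<omega> s $ s"
  obtains x where "x$s = 0" "bf x x < 0"
proof -
  define k where "k = perron$s / \<omega> s $ s"
  let ?x = "perron - k *\<^sub>R \<omega> s"
  have "bf ?x ?x = bf perron perron - 2 * k * perron$s + k\<^sup>2 * \<omega> s $ s"
    by (simp add: bf_simps bf_weight power2_eq_square right_diff_distrib)
  also have "\<dots> = bf perron perron - (perron$s)\<^sup>2 / \<omega> s $ s"
    using assms by (simp add: k_def power2_eq_square)
  also have "\<dots> < 0" using perron_timelike assms by (smt (verit) divide_nonneg_pos zero_le_power2)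
  finally show ?thesis using that[of ?x] assms by (simp add: k_def)
qed

text \<open>
  Let \<open>y\<close> be the part of the weight off \<open>\<alpha> s\<close> and \<open>q\<close> the Perron vector of the complement of \<open>s\<close>. If \<open>y\<close>
  had a positive coordinate, then \<open>y - k *\<^sub>R q\<close>, with the least \<open>k\<close> that makes it nonpositive, would have
  two zero coordinates and negative norm.
\<close>

lemma real_weight_nonpos:
  assumes s: "0 < \<omega> s $ s" and r: "r \<noteq> s"
  shows "\<omega> s $ r \<le> 0"
proof (rule ccontr)
  assume neg: "\<not> \<omega> s $ r \<le> 0"
  obtain x where x: "x$s = 0" "bf x x < 0" using real_weight_complement[OF s] .
  have x': "\<And>i. i \<notin> - {s} \<Longrightarrow> x$i = 0" using x by auto
  obtain q \<mu> where "\<mu> > 0 \<and> q \<noteq> 0 \<and> (\<forall>i. 0 \<le> q$i) \<and> (\<forall>i. i \<notin> - {s} \<longrightarrow> q$i = 0) \<and>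
    (\<forall>i\<in>- {s}. bf (\<alpha> i) q = - \<mu> * q$i)"
    using perron_vector[OF x(2) x'] by blast
  then have q: "\<mu> > 0" "q \<noteq> 0" "\<And>i. 0 \<le> q$i" "q $ s = 0"
    "\<And>i. i \<noteq> s \<Longrightarrow> bf (\<alpha> i) q = - \<mu> * q $ i"
    by simp_all
  have qq: "bf q q < 0"
  proof -
    have "bf q q = (\<Sum>i\<in>UNIV. - \<mu> * (q$i * q$i))"
    proof (subst bf_expand, intro sum.cong refl)
      fix i show "q$i * bf (\<alpha> i) q = - \<mu> * (q$i * q$i)"
        using q(4) q(5)[of i] by (cases "i = s") auto
    qed
    also have "\<dots> = - \<mu> * (q \<bullet> q)" by (simp add: inner_vec_def sum_distrib_left)
    finally show ?thesis using q by simp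
  qed
  \<comment> \<open>A further zero coordinate would contradict \<open>qq\<close> by
    \<open>codim_two_psd\<close>; this takes the place of connectedness of the graph without
    \<open>s\<close>.\<close>
  have qpos: "q$i > 0" if "i \<noteq> s" for i
    using codim_two_psd[of i s q] q(3)[of i] q(4) qq that by (smt (verit))
  define y where "y = \<omega> s - \<omega> s $ s *\<^sub>R \<alpha> s"
  have ynth: "y$i = (if i = s then 0 else \<omega> s $ i)" for i by (simp add: y_def axis_def)
  have By: "0 \<le> bf (\<alpha> i) y" if "i \<noteq> s" for i
  proof -
    have "\<omega> s $ s * B$i$s \<le> 0" using s nonpos[OF that] by (intro mult_nonneg_nonpos) auto
    then show ?thesis using that by (simp add: y_def bf_simps bf_root_weight bf_root_root)
  qed
  let ?M = "(\<lambda>i. y$i / q$i) ` (-{s})"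
  define k where "k = Max ?M"
  have "k \<in> ?M" unfolding k_def using r by (intro Max_in) auto
  then obtain u where u: "u \<noteq> s" "k = y$u / q$u" by auto
  have kge: "y$i / q$i \<le> k" if "i \<noteq> s" for i
    unfolding k_def using that by (intro Max_ge) auto
  have k: "k > 0" using kge[OF r] neg qpos[OF r] ynth r by (smt (verit) divide_pos_pos)
  define z where "z = y - k *\<^sub>R q"
  have zle: "z$i \<le> 0" for i
    using kge[of i] qpos[of i] q(4) ynth[of i] by (cases "i = s") (auto simp: z_def field_simps)
  have Bz: "bf (\<alpha> i) z \<ge> k * \<mu> * q$i" if "i \<noteq> s" for i
    using By[OF that] q(5)[OF that] by (simp add: z_def bf_simps)
  have term_le: "z$i * bf (\<alpha> i) z \<le> 0" for i
  proof (cases "i = s")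
    case False
    have "0 \<le> bf (\<alpha> i) z" using Bz[OF False] k q(1) qpos[OF False]
      by (smt (verit) mult_pos_pos)
    then show ?thesis using zle[of i] by (simp add: mult_nonpos_nonneg)
  qed (simp add: z_def ynth q(4))
  have zs: "z$s = 0" by (simp add: z_def ynth q(4))
  have zu: "z$u = 0" using u qpos[OF u(1)] by (simp add: z_def)
  \<comment> \<open>The norm is a sum of nonpositive terms, so all of them vanish. Off
    \<open>s\<close> the second factors are strictly positive, which forces \<open>z = 0\<close> and
    contradicts that very positivity at \<open>r\<close>.\<close>
  have "0 \<le> bf z z" using codim_two_psd[OF u(1) zu zs] .
  then have "(\<Sum>i\<in>UNIV. z$i * bf (\<alpha> i) z) = 0"
    using bf_expand[of z z] sum_nonpos[of UNIV "\<lambda>i. z$i * bf (\<alpha> i) z"] term_le by auto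
  then have "(\<Sum>i\<in>UNIV. - (z$i * bf (\<alpha> i) z)) = 0" by (simp add: sum_negf)
  then have each: "z$i * bf (\<alpha> i) z = 0" for i
    using term_le by (subst (asm) sum_nonneg_eq_0_iff) auto
  have "z = 0"
  proof (subst vec_eq_iff, rule)
    fix i show "z$i = 0 $ i"
    proof (cases "i = s")
      case False
      then have "bf (\<alpha> i) z > 0" using Bz[OF False] k q(1) qpos[OF False]
        by (smt (verit) mult_pos_pos)
      then show ?thesis using each[of i] by simp
    qed (simp add: zs)
  qed
  then have "bf (\<alpha> r) z = 0" by (simp add: bf_simps)
  then show False using Bz[OF r] k q(1) qpos[OF r] by (smt (verit) mult_pos_pos)
qed

text \<open>The part \<open>y\<close> of the weight off \<open>\<alpha> s\<close> has norm
  \<open>N\<^sup>2 - N\<close>. Its coordinates are nonpositive while its products with the other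
  simple roots are nonnegative, so this norm is at most 0.\<close>

lemma real_weight_le_1:
  assumes s: "0 < \<omega> s $ s"
  shows "\<omega> s $ s \<le> 1"
proof -
  define N where "N = \<omega> s $ s"
  define y where "y = \<omega> s - N *\<^sub>R \<alpha> s"
  have yy: "bf y y = N\<^sup>2 - N"
    by (simp add: y_def bf_simps bf_weight bf_root_root bf_root_weight diag N_def
        power2_eq_square algebra_simps)
  have "bf y y = (\<Sum>i\<in>UNIV. y$i * bf (\<alpha> i) y)" by (rule bf_expand)
  also have "\<dots> \<le> 0"
  proof (rule sum_nonpos)
    fix i show "y$i * bf (\<alpha> i) y \<le> 0"
    proof (cases "i = s")
      case True then show ?thesis by (simp add: y_def N_def)
    next
      case False
      have "N * B$i$s \<le> 0" using s nonpos[OF False] by (intro mult_nonneg_nonpos) (auto simp: N_def)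
      then have "0 \<le> bf (\<alpha> i) y"
        using False by (simp add: y_def bf_simps bf_root_weight bf_root_root)
      moreover have "y$i \<le> 0" using real_weight_nonpos[OF s False] False by (simp add: y_def axis_def)
      ultimately show ?thesis by (simp add: mult_nonpos_nonneg)
    qed
  qed
  finally have "N * N \<le> N * 1" using yy by (simp add: power2_eq_square)
  then show ?thesis using s by (simp add: N_def)
qed

text \<open>
  If the weights spanned a positive definite plane, the projection of \<open>perron\<close> along it would be a
  timelike vector with zero coordinates at \<open>s\<close> and \<open>t\<close>.
\<close>

lemma real_weights_gram:
  assumes s: "0 < \<omega> s $ s" and t: "0 < \<omega> t $ t" and st: "s \<noteq> t"
  shows "\<omega> s $ t \<le> - sqrt (\<omega> s $ s * \<omega> t $ t)"
proof -
  define a b c where "a = \<omega> s $ s" and "b = \<omega> t $ t" and "c = \<omega> s $ t"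
  have "a * b \<le> c\<^sup>2"
  proof (rule ccontr)
    assume "\<not> a * b \<le> c\<^sup>2"
    define d where "d = a * b - c\<^sup>2"
    have d: "d > 0" using \<open>\<not> a * b \<le> c\<^sup>2\<close> by (simp add: d_def)
    \<comment> \<open>Cramer's rule for the orthogonal projection \<open>x\<close> of
      \<open>perron\<close> to the plane of the two weights: products with them are coordinates, so
      \<open>x\<close> must agree with \<open>perron\<close> at \<open>s\<close> and
      \<open>t\<close>.\<close>
    define k l where "k = (b * perron$s - c * perron$t) / d" and "l = (a * perron$t - c * perron$s) / d"
    have k1: "k * a + l * c = perron$s"
      unfolding k_def l_def using d by (simp add: field_simps) (simp add: d_def algebra_simps power2_eq_square)
    have k2: "k * c + l * b = perron$t"
      unfolding k_def l_def using d by (simp add: field_simps) (simp add: d_def algebra_simps power2_eq_square)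
    define x where "x = k *\<^sub>R \<omega> s + l *\<^sub>R \<omega> t"
    have ts: "\<omega> t $ s = c" unfolding c_def by (rule weight_sym)
    have xs: "x$s = perron$s" "x$t = perron$t"
      using k1 k2 by (simp_all add: x_def ts flip: a_def b_def c_def)
    have xx: "bf x x = k\<^sup>2 * a + 2 * k * l * c + l\<^sup>2 * b"
      by (simp add: x_def bf_simps bf_weight ts power2_eq_square algebra_simps flip: a_def b_def c_def)
    also have "\<dots> = ((k * a + l * c)\<^sup>2 + l\<^sup>2 * d) / a"
      using s by (simp add: a_def[symmetric] d_def field_simps power2_eq_square)
    also have "\<dots> \<ge> 0" using s d by (simp add: a_def)
    finally have pos: "0 \<le> bf x x" .
    have xp: "bf x perron = bf x x"
    proof -
      have "bf x y = k * y$s + l * y$t" for y by (simp add: x_def bf_simps bf_weight)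
      from this[of perron] this[of x] show ?thesis using xs by simp
    qed
    have "bf (perron - x) (perron - x) = bf perron perron - bf x x"
      using xp by (simp add: bf_simps bf_commute[of perron x])
    then have "bf (perron - x) (perron - x) < 0" using pos perron_timelike by linarith
    moreover have "0 \<le> bf (perron - x) (perron - x)"
      using xs by (intro codim_two_psd[OF st]) auto
    ultimately show False by simp
  qed
  moreover have "c \<le> 0" unfolding c_def using real_weight_nonpos[OF s] st by simp
  ultimately have "sqrt (a * b) \<le> - c"
    by (metis abs_of_nonpos power2_abs real_le_lsqrt real_sqrt_abs real_sqrt_le_iff)
  then show ?thesis by (simp add: a_def b_def c_def)
qed

end

section \<open>Words in the simple reflections and the positivity of roots\<close>

context coxeter_form
begin

abbreviation refl :: "'s \<Rightarrow> real^'s \<Rightarrow> real^'s" where "refl s \<equiv> reflection B (\<alpha> s)"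

lemma refl_eq: "refl s x = x - (2 * bf (\<alpha> s) x) *\<^sub>R \<alpha> s"
  by (simp add: reflection_def bf_root_root diag bf_commute[of x])

lemma refl_refl: "refl s (refl s x) = x"
  by (simp add: refl_eq bf_simps bf_root_root diag vec_eq_iff algebra_simps)

lemma linear_refl: "linear (refl s)"
  by (rule linearI) (simp_all add: refl_eq bf_simps algebra_simps)

lemma bf_refl: "bf (refl s x) (refl s y) = bf x y"
  by (simp add: refl_eq bf_simps bf_root_root diag bf_commute[of x "\<alpha> s"] algebra_simps)

lemma refl_root: "refl s (\<alpha> s) = - \<alpha> s"
  by (simp add: refl_eq bf_root_root diag vec_eq_iff)

primrec act :: "'s list \<Rightarrow> real^'s \<Rightarrow> real^'s" where
  "act [] x = x"
| "act (s # xs) x = refl s (act xs x)"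

lemma act_append: "act (xs @ ys) x = act xs (act ys x)"
  by (induction xs) simp_all

lemma linear_act: "linear (act xs)"
proof (induction xs)
  case (Cons s xs)
  have "linear (refl s \<circ> act xs)" by (rule linear_compose[OF Cons linear_refl])
  then show ?case by (simp add: comp_def)
qed (simp add: linear_id[unfolded id_def])

lemmas act_simps = linear_add[OF linear_act] linear_diff[OF linear_act] linear_neg[OF linear_act]
  linear_scale[OF linear_act] linear_sum[OF linear_act] linear_0[OF linear_act]

lemma bf_act: "bf (act xs x) (act xs y) = bf x y"
  by (induction xs) (simp_all add: bf_refl)

lemma act_rev: "act (rev xs) (act xs x) = x" "act xs (act (rev xs) x) = x"
proof -
  have *: "act (rev xs) (act xs x) = x" for xs x
    by (induction xs arbitrary: x) (simp_all add: act_append refl_refl)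
  show "act (rev xs) (act xs x) = x" "act xs (act (rev xs) x) = x"
    using *[of xs x] *[of "rev xs" x] by simp_all
qed

lemma bf_act_left: "bf (act xs x) y = bf x (act (rev xs) y)"
  using bf_act[of "rev xs" "act xs x" y] by (simp add: act_rev)

text \<open>Words are compared through their action on the space, so this is length in the linear
  group generated by the simple reflections.\<close>

definition reduced :: "'s list \<Rightarrow> bool" where
  "reduced xs \<longleftrightarrow> (\<forall>ys. act ys = act xs \<longrightarrow> length xs \<le> length ys)"

lemma reduced_ex: "\<exists>ys. act ys = act xs \<and> reduced ys"
proof -
  obtain ys where "act ys = act xs" "\<And>zs. act zs = act xs \<Longrightarrow> length ys \<le> length zs"
    using ex_has_least_nat[of "\<lambda>ys. act ys = act xs" xs length] by blast
  then show ?thesis unfolding reduced_def by force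
qed

lemma reduced_infix:
  assumes "reduced (us @ xs @ vs)" shows "reduced xs"
  unfolding reduced_def
proof (intro allI impI)
  fix ys assume "act ys = act xs"
  then have "act (us @ ys @ vs) = act (us @ xs @ vs)" by (auto simp: fun_eq_iff act_append)
  then have "length (us @ xs @ vs) \<le> length (us @ ys @ vs)" using assms unfolding reduced_def by blast
  then show "length xs \<le> length ys" by simp
qed

lemma reduced_prefix: "reduced (xs @ ys) \<Longrightarrow> reduced xs"
  using reduced_infix[of "[]"] by simp

lemma reduced_suffix: "reduced (xs @ ys) \<Longrightarrow> reduced ys"
  using reduced_infix[of xs ys "[]"] by simp

lemma act_rev_cong:
  assumes "act xs = act ys" shows "act (rev xs) = act (rev ys)"
proof
  fix x
  have "act (rev xs) x = act (rev xs) (act ys (act (rev ys) x))" by (simp add: act_rev)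
  also have "\<dots> = act (rev ys) x" by (simp add: act_rev flip: assms)
  finally show "act (rev xs) x = act (rev ys) x" .
qed

lemma reduced_rev: assumes "reduced xs" shows "reduced (rev xs)"
  unfolding reduced_def
proof (intro allI impI)
  fix ys assume "act ys = act (rev xs)"
  then have "act (rev ys) = act xs" using act_rev_cong[of ys "rev xs"] by simp
  then show "length (rev xs) \<le> length ys" using assms unfolding reduced_def by fastforce
qed

lemma reduced_distinct_adj: "reduced xs \<Longrightarrow> distinct_adj xs"
proof (induction xs rule: induct_list012)
  case (3 a b xs)
  have "a \<noteq> b"
  proof
    assume "a = b"
    then have "act [] = act [a,b]" by (auto simp: refl_refl)
    moreover have "reduced [a,b]" using reduced_prefix[of "[a,b]" xs] 3(3) by simp
    ultimately show False unfolding reduced_def by force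
  qed
  moreover have "distinct_adj (b # xs)" using 3 reduced_suffix[of "[a]" "b # xs"] by simp
  ultimately show ?case by simp
qed simp_all

text \<open>The alternating word of length \<open>k\<close> in \<open>s\<close>, \<open>t\<close> that ends in \<open>t\<close>.\<close>

primrec alt_word :: "nat \<Rightarrow> 's \<Rightarrow> 's \<Rightarrow> 's list" where
  "alt_word 0 s t = []"
| "alt_word (Suc k) s t = alt_word k t s @ [t]"

lemma length_alt_word [simp]: "length (alt_word k s t) = k"
  by (induction k arbitrary: s t) auto

lemma alt_word_add: "\<exists>zs. alt_word (i + j) s t = zs @ alt_word j s t \<and> length zs = i"
proof (induction j arbitrary: s t)
  case (Suc j)
  then obtain zs where "alt_word (i + j) t s = zs @ alt_word j t s" "length zs = i" by blast
  then show ?case by auto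
qed auto

lemma alt_word_double: "alt_word (2 * k) s t = concat (replicate k [s,t])"
proof (induction k)
  case (Suc k)
  have "concat (replicate (Suc k) [s,t]) = concat (replicate k [s,t]) @ [s,t]"
    by (subst replicate_Suc, subst replicate_append_same[symmetric]) simp
  then show ?case using Suc by simp
qed simp

lemma alt_word_eq:
  assumes "distinct_adj ys" "set ys \<subseteq> {s,t}" "ys \<noteq> [] \<Longrightarrow> last ys = t"
  shows "ys = alt_word (length ys) s t"
  using assms
proof (induction ys arbitrary: s t rule: rev_induct)
  case (snoc a ys)
  have a: "a = t" using snoc.prems(3) by simp
  have "ys \<noteq> [] \<Longrightarrow> last ys = s"
    using snoc.prems(1,2) a by (auto simp: distinct_adj_append_iff dest: last_in_set)
  moreover have "distinct_adj ys" using snoc.prems(1) by (auto simp: distinct_adj_append_iff)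
  moreover have "set ys \<subseteq> {t,s}" using snoc.prems(2) by auto
  ultimately have "ys = alt_word (length ys) t s" using snoc.IH by blast
  then show ?case using a by simp
qed simp

end

text \<open>Chebyshev polynomials of the second kind, shifted by one: \<open>cheb (2 cos \<theta>) k = sin (k \<theta>) / sin \<theta>\<close>.\<close>

fun cheb :: "real \<Rightarrow> nat \<Rightarrow> real" where
  "cheb b 0 = 0"
| "cheb b (Suc 0) = 1"
| "cheb b (Suc (Suc k)) = b * cheb b (Suc k) - cheb b k"

lemma cheb_mono:
  assumes "2 \<le> b"
  shows "0 \<le> cheb b k \<and> cheb b k \<le> cheb b (Suc k)"
proof (induction k)
  case (Suc k)
  have "2 * cheb b (Suc k) \<le> b * cheb b (Suc k)" using assms Suc by (intro mult_right_mono) auto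
  then show ?case using Suc by simp
qed simp

lemma cheb_sin: "cheb (2 * cos \<theta>) k * sin \<theta> = sin (real k * \<theta>)"
proof (induction "2 * cos \<theta>" k rule: cheb.induct)
  case (3 k)
  define a where "a = real (Suc k) * \<theta>"
  have "sin (real (Suc (Suc k)) * \<theta>) = sin (a + \<theta>)" "sin (real k * \<theta>) = sin (a - \<theta>)"
    by (simp_all add: a_def algebra_simps)
  moreover have "sin (a + \<theta>) = 2 * cos \<theta> * sin a - sin (a - \<theta>)" by (simp add: sin_add sin_diff)
  ultimately show ?case
    using 3 by (simp only: cheb.simps left_diff_distrib mult.assoc a_def)
qed simp_all

section \<open>Dihedral subgroups and the sign of roots\<close>

context coxeter_form
begin

text \<open>The innermost letter turns \<open>\<alpha> s\<close> into
  \<open>\<alpha> s + b *\<^sub>R \<alpha> t\<close>. The next letter negates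
  \<open>\<alpha> s\<close>, which produces the Chebyshev recursion; the parity of \<open>k\<close>
  decides which root carries the higher index.\<close>

lemma act_alt_word:
  assumes b: "b = - 2 * B$s$t"
  shows "act (alt_word k s t) (\<alpha> s) =
    (if even k then cheb b (Suc k) *\<^sub>R \<alpha> s + cheb b k *\<^sub>R \<alpha> t
     else cheb b k *\<^sub>R \<alpha> s + cheb b (Suc k) *\<^sub>R \<alpha> t)"
  using b
proof (induction k arbitrary: s t rule: less_induct)
  case (less k)
  have rt: "refl t (\<alpha> s) = \<alpha> s + b *\<^sub>R \<alpha> t" if "b = - 2 * B$s$t" for s t
    by (simp add: refl_eq bf_root_root that symm[of t s])
  consider "k = 0" | "k = 1" | j where "k = Suc (Suc j)" by (metis One_nat_def not0_implies_Suc)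
  then show ?case
  proof cases
    case 3
    have b': "b = - 2 * B$t$s" using less.prems symm[of s t] by simp
    have "act (alt_word k s t) (\<alpha> s) = act (alt_word (Suc j) t s) (\<alpha> s + b *\<^sub>R \<alpha> t)"
      using rt[OF less.prems] by (simp add: 3 act_append)
    also have "\<dots> = b *\<^sub>R act (alt_word (Suc j) t s) (\<alpha> t) - act (alt_word j s t) (\<alpha> s)"
      by (simp add: act_simps) (simp add: act_append refl_root act_simps)
    also have "\<dots> = (if even k then cheb b (Suc k) *\<^sub>R \<alpha> s + cheb b k *\<^sub>R \<alpha> t
     else cheb b k *\<^sub>R \<alpha> s + cheb b (Suc k) *\<^sub>R \<alpha> t)"
      using less.IH[of "Suc j" t s, OF _ b'] less.IH[of j s t, OF _ less.prems]
      by (simp add: 3 del: alt_word.simps) (simp add: algebra_simps)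
    finally show ?thesis .
  qed (use rt[OF less.prems] in simp_all)
qed


end

locale coxeter_reflections = coxeter_form B for B :: "real^'s::finite^'s" +
  fixes m :: "'s \<Rightarrow> 's \<Rightarrow> enat"
  assumes m_sym: "m s t = m t s"
    and m_ge_2: "s \<noteq> t \<Longrightarrow> 2 \<le> m s t"
    and B_finite: "m s t = enat k \<Longrightarrow> B$s$t = - cos (pi / real k)"
    and B_infinite: "m s t = \<infinity> \<Longrightarrow> B$s$t \<le> -1"
    and braid: "m s t = enat k \<Longrightarrow> act (concat (replicate k [s,t])) x = x"
begin

text \<open>For finite \<open>m s t\<close> the argument is twice the cosine of \<theta> = pi /
  \<open>m s t\<close>, and \<open>real k * \<theta>\<close> does not exceed pi; for infinite
  \<open>m s t\<close> it is at least 2, where the sequence is nondecreasing.\<close>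

lemma cheb_nonneg:
  assumes "s \<noteq> t" "enat k \<le> m s t"
  shows "0 \<le> cheb (- 2 * B$s$t) k"
proof (cases "m s t")
  case infinity
  have "2 \<le> - 2 * B$s$t" using B_infinite[OF infinity] by simp
  then show ?thesis using cheb_mono by blast
next
  case (enat n)
  define \<theta> where "\<theta> = pi / real n"
  have n: "2 \<le> n" using m_ge_2[OF assms(1)] enat by (simp add: numeral_eq_enat)
  have k: "k \<le> n" using assms(2) enat by simp
  have "sin \<theta> > 0" using n by (intro sin_gt_zero) (simp_all add: \<theta>_def field_simps)
  moreover have "0 \<le> sin (real k * \<theta>)"
  proof (rule sin_ge_zero)
    have "real k * \<theta> \<le> real n * \<theta>" using k by (intro mult_right_mono) (auto simp: \<theta>_def)
    then show "real k * \<theta> \<le> pi" using n by (simp add: \<theta>_def)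
  qed (simp add: \<theta>_def)
  moreover have "- 2 * B$s$t = 2 * cos \<theta>" using B_finite[OF enat] by (simp add: \<theta>_def)
  ultimately show ?thesis using cheb_sin[of \<theta> k] by (metis linorder_not_le mult_neg_pos)
qed

text \<open>The alternating word of length \<open>2 * k\<close> acts trivially, so its suffix of
  length \<open>k + 1\<close> acts as the reverse of its prefix of length \<open>k - 1\<close>: two
  letters are saved.\<close>

lemma alt_word_shorten:
  assumes "m s t = enat k" "k \<le> L" "0 < k"
  shows "\<exists>zs. act zs = act (alt_word (Suc L) t s) \<and> length zs < L"
proof -
  obtain us where us: "alt_word ((k - 1) + Suc k) t s = us @ alt_word (Suc k) t s" "length us = k - 1"
    using alt_word_add by blast
  obtain vs where vs: "alt_word ((L - k) + Suc k) t s = vs @ alt_word (Suc k) t s" "length vs = L - k"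
    using alt_word_add by blast
  have "(k - 1) + Suc k = 2 * k" using assms by simp
  then have "act (us @ alt_word (Suc k) t s) x = x" for x
    using braid[of t s k x] us(1) alt_word_double[of k t s] assms(1) m_sym[of t s] by metis
  then have "act (alt_word (Suc k) t s) x = act (rev us) x" for x
    by (metis act_append act_rev(1))
  then have "act (vs @ rev us) = act (alt_word ((L - k) + Suc k) t s)"
    unfolding vs(1) by (auto simp: fun_eq_iff act_append simp del: alt_word.simps)
  moreover have "(L - k) + Suc k = Suc L" using assms by simp
  moreover have "length (vs @ rev us) < L" using us vs assms by simp
  ultimately show ?thesis by metis
qed

text \<open>
  The word is split as \<open>us @ ys\<close> with \<open>ys\<close> a longest possible suffix from the dihedral subgroup
  \<open>\<langle>s, t\<rangle>\<close>, where \<open>t\<close> is its last letter: \<open>act ys\<close> sends \<open>\<alpha> s\<close> to a nonnegative combination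
  of \<open>\<alpha> s\<close> and \<open>\<alpha> t\<close>, both of which remain nonnegative under the shorter word \<open>us\<close>.
\<close>

lemma act_root_nonneg:
  assumes "reduced xs" "\<And>zs. act zs = act (xs @ [s]) \<Longrightarrow> length xs \<le> length zs"
  shows "0 \<le> act xs (\<alpha> s) $ u"
  using assms
proof (induction "length xs" arbitrary: xs s rule: less_induct)
  case less
  show ?case
  proof (cases xs rule: rev_cases)
    case Nil then show ?thesis by (simp add: axis_def)
  next
    case (snoc xs' t)
    have ts: "t \<noteq> s"
    proof
      assume "t = s"
      then have "act xs' = act (xs @ [s])" by (auto simp: snoc act_append refl_refl)
      from less.prems(2)[OF this] show False by (simp add: snoc)
    qed
    define P where "P us \<longleftrightarrow> (\<exists>ys. act (us @ ys) = act xs \<and> length us + length ys = length xs \<and> set ys \<subseteq> {s,t})" for us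
    have "P xs'" unfolding P_def by (rule exI[of _ "[t]"]) (simp add: snoc)
    then obtain us where us: "P us" "\<And>vs. P vs \<Longrightarrow> length us \<le> length vs"
      using ex_has_least_nat[of P xs' length] by blast
    then obtain ys where ys: "act (us @ ys) = act xs" "length us + length ys = length xs" "set ys \<subseteq> {s,t}"
      unfolding P_def by blast
    have lt: "length us < length xs" using us(2)[OF \<open>P xs'\<close>] by (simp add: snoc)
    have red: "reduced (us @ ys)" using less.prems(1) ys(1,2) unfolding reduced_def by simp
    \<comment> \<open>If appending \<open>r\<close> shortened \<open>us\<close>, then
      \<open>r\<close> could move into the dihedral suffix, against the choice of a shortest
      \<open>us\<close>.\<close>
    have step: "length us \<le> length zs" if r: "r \<in> {s,t}" and zs: "act zs = act (us @ [r])" for r zs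
    proof (rule ccontr)
      assume lz: "\<not> length us \<le> length zs"
      have eq: "act (zs @ r # ys) = act xs"
        using zs by (auto simp: fun_eq_iff act_append refl_refl ys(1)[symmetric])
      then have "length xs \<le> length (zs @ r # ys)" using less.prems(1) unfolding reduced_def by blast
      then have "length zs + length (r # ys) = length xs" using lz ys(2) by simp
      moreover have "set (r # ys) \<subseteq> {s,t}" using r ys(3) by auto
      ultimately have "P zs" unfolding P_def using eq by blast
      then show False using us(2) lz by blast
    qed
    have nonneg: "0 \<le> act us (\<alpha> r) $ u" if "r \<in> {s,t}" for r
      using less.hyps[OF lt reduced_prefix[OF red]] step[OF that] by blast
    have long: "length xs \<le> length us + length zs" if "act zs = act (ys @ [s])" for zs
    proof -
      have "act (us @ zs) x = act (xs @ [s]) x" for x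
        using that ys(1) by (simp add: act_append fun_eq_iff)
      then show ?thesis using less.prems(2)[of "us @ zs"] by auto
    qed
    have last: "last ys = t" if "ys \<noteq> []"
    proof (rule ccontr)
      assume "last ys \<noteq> t"
      then have "last ys = s" using ys(3) last_in_set[OF that] by blast
      then have "ys = butlast ys @ [s]" using that by (metis append_butlast_last_id)
      then have "act (butlast ys) = act (ys @ [s])"
        by (metis (no_types, lifting) act_append act.simps refl_refl ext)
      moreover have "0 < length ys" using that by simp
      ultimately show False using long[of "butlast ys"] ys(2) unfolding length_butlast by linarith
    qed
    define L where "L = length ys"
    have alt: "ys = alt_word L s t"
      unfolding L_def using alt_word_eq[OF reduced_distinct_adj[OF reduced_suffix[OF red]] ys(3) last] .
    \<comment> \<open>The coefficients of \<open>act ys (\<alpha> s)\<close> have indices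
      \<open>L\<close> and \<open>Suc L\<close>, so the bound is needed at \<open>Suc L\<close>. If
      it failed, the braid relation would shorten \<open>ys @ [s]\<close>, which \<open>long\<close>
      forbids.\<close>
    have "enat (Suc L) \<le> m s t"
    proof (cases "m s t")
      case (enat k)
      have "2 \<le> k" using m_ge_2[of s t] ts enat by (simp add: numeral_eq_enat)
      then have k: "0 < k" by simp
      have "\<not> k \<le> L"
      proof
        assume "k \<le> L"
        then obtain zs where zs: "act zs = act (alt_word (Suc L) t s)" "length zs < L"
          using alt_word_shorten[OF enat _ k] by blast
        then have "act zs = act (ys @ [s])" by (simp add: alt)
        from long[OF this] show False using zs(2) ys(2) L_def by simp
      qed
      then show ?thesis using enat by simp
    qed simp
    moreover from this have "enat L \<le> m s t" by (rule order_trans[rotated]) simp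
    ultimately have nn: "0 \<le> cheb (- 2 * B$s$t) (Suc L)" "0 \<le> cheb (- 2 * B$s$t) L"
      using cheb_nonneg[of s t] ts by blast+
    obtain p q where pq: "p \<ge> 0" "q \<ge> 0" "act ys (\<alpha> s) = p *\<^sub>R \<alpha> s + q *\<^sub>R \<alpha> t"
    proof (cases "even L")
      case True
      then have "act ys (\<alpha> s) = cheb (- 2 * B$s$t) (Suc L) *\<^sub>R \<alpha> s + cheb (- 2 * B$s$t) L *\<^sub>R \<alpha> t"
        unfolding alt by (simp only: act_alt_word[OF refl] if_True)
      then show ?thesis by (rule that[OF nn])
    next
      case False
      then have "act ys (\<alpha> s) = cheb (- 2 * B$s$t) L *\<^sub>R \<alpha> s + cheb (- 2 * B$s$t) (Suc L) *\<^sub>R \<alpha> t"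
        unfolding alt by (simp only: act_alt_word[OF refl] if_False)
      then show ?thesis by (rule that[OF nn(2,1)])
    qed
    have "act xs (\<alpha> s) = p *\<^sub>R act us (\<alpha> s) + q *\<^sub>R act us (\<alpha> t)"
      by (simp add: ys(1)[symmetric] act_append pq(3) act_simps)
    then show ?thesis using nonneg[of s] nonneg[of t] pq by simp
  qed
qed

lemma reduced_snoc_root_nonneg:
  assumes "reduced (xs @ [s])"
  shows "0 \<le> act xs (\<alpha> s) $ u"
proof (rule act_root_nonneg)
  show "reduced xs" using assms by (rule reduced_prefix)
  fix zs assume "act zs = act (xs @ [s])"
  then show "length xs \<le> length zs" using assms unfolding reduced_def by fastforce
qed

lemma act_snoc: "act (xs @ [s]) x = act xs x - (2 * bf (\<alpha> s) x) *\<^sub>R act xs (\<alpha> s)"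
  by (simp add: act_append refl_eq act_simps)

lemma act_chamber_antimono:
  assumes "\<And>s. 0 \<le> bf (\<alpha> s) x" "reduced (xs @ ys)"
  shows "act (xs @ ys) x $ u \<le> act xs x $ u"
  using assms(2)
proof (induction ys rule: rev_induct)
  case (snoc s ys)
  have "reduced ((xs @ ys) @ [s])" using snoc.prems by simp
  then have "0 \<le> act (xs @ ys) (\<alpha> s) $ u" "reduced (xs @ ys)"
    using reduced_snoc_root_nonneg reduced_prefix by blast+
  then have "act ((xs @ ys) @ [s]) x $ u \<le> act (xs @ ys) x $ u"
    unfolding act_snoc using assms(1)[of s] by simp
  then show ?case using snoc.IH \<open>reduced (xs @ ys)\<close> by simp
qed simp

lemma act_chamber_le:
  assumes "\<And>s. 0 \<le> bf (\<alpha> s) x"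
  shows "act xs x $ u \<le> x $ u"
proof -
  obtain ys where "act ys = act xs" "reduced ys" using reduced_ex by blast
  then show ?thesis using act_chamber_antimono[OF assms, of "[]" ys u] by simp
qed

text \<open>Both vectors lie in the closed chamber, so each bounds the other in every
  coordinate.\<close>

lemma fundamental_domain:
  assumes "\<And>s. 0 \<le> bf (\<alpha> s) x" "\<And>s. 0 \<le> bf (\<alpha> s) (act xs x)"
  shows "act xs x = x"
proof (subst vec_eq_iff, rule)
  fix u
  show "act xs x $ u = x $ u"
    using act_chamber_le[OF assms(1), of xs u] act_chamber_le[OF assms(2), of "rev xs" u]
    by (simp add: act_rev)
qed

section \<open>Shortest representatives of double cosets of maximal parabolic subgroups\<close>

definition double_coset_minimal :: "'s \<Rightarrow> 's \<Rightarrow> 's list \<Rightarrow> bool" where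
  "double_coset_minimal s t xs \<longleftrightarrow>
     (\<forall>us ys vs. s \<notin> set us \<longrightarrow> t \<notin> set vs \<longrightarrow> act (us @ ys @ vs) = act xs \<longrightarrow> length xs \<le> length ys)"

text \<open>Words without the letter \<open>s\<close> fix \<open>\<omega> s\<close>. Hence the
  product of \<open>\<omega> s\<close> with a translate of \<open>\<omega> t\<close> depends only on
  the double coset, and a shortest word in it may be used.\<close>

lemma double_coset_decomposition:
  "\<exists>us ys vs. s \<notin> set us \<and> t \<notin> set vs \<and> act xs = act (us @ ys @ vs) \<and> double_coset_minimal s t ys"
proof -
  define P where "P ys \<longleftrightarrow> (\<exists>us vs. s \<notin> set us \<and> t \<notin> set vs \<and> act xs = act (us @ ys @ vs))" for ys
  have "P xs" unfolding P_def by (rule exI[of _ "[]"], rule exI[of _ "[]"]) simp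
  then obtain ys where ys: "P ys" "\<And>zs. P zs \<Longrightarrow> length ys \<le> length zs"
    using ex_has_least_nat[of P xs length] by blast
  then obtain us vs where uv: "s \<notin> set us" "t \<notin> set vs" "act xs = act (us @ ys @ vs)"
    unfolding P_def by blast
  have "double_coset_minimal s t ys"
    unfolding double_coset_minimal_def
  proof (intro allI impI)
    fix us' zs vs' assume *: "s \<notin> set us'" "t \<notin> set vs'" "act (us' @ zs @ vs') = act ys"
    have "act xs = act ((us @ us') @ zs @ (vs' @ vs))"
      unfolding uv(3) using *(3) by (simp add: fun_eq_iff act_append)
    then have "P zs" unfolding P_def using uv(1,2) *(1,2)
      by (intro exI[of _ "us @ us'"] exI[of _ "vs' @ vs"]) simp
    then show "length ys \<le> length zs" by (rule ys(2))
  qed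
  then show ?thesis using uv by blast
qed

lemma double_coset_minimalD:
  "double_coset_minimal s t xs \<Longrightarrow> s \<notin> set us \<Longrightarrow> t \<notin> set vs \<Longrightarrow> act (us @ ys @ vs) = act xs
    \<Longrightarrow> length xs \<le> length ys"
  unfolding double_coset_minimal_def by blast

lemma double_coset_minimal_reduced: "double_coset_minimal s t xs \<Longrightarrow> reduced xs"
  unfolding reduced_def using double_coset_minimalD[of s t xs "[]" "[]"] by simp

text \<open>Any other last letter could be moved into the right parabolic factor.\<close>

lemma double_coset_minimal_last:
  assumes "double_coset_minimal s t (xs @ [r])" shows "r = t"
  using double_coset_minimalD[OF assms, of "[]" "[r]" xs] by force

lemma double_coset_minimal_hd:
  assumes "double_coset_minimal s t (r # xs)" shows "r = s"
  using double_coset_minimalD[OF assms, of "[r]" "[]" xs] by force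

text \<open>
  If the coefficient vanished, \<open>act xs (\<alpha> t)\<close> would be a nonnegative combination of the \<open>\<alpha> j\<close> with
  \<open>j \<noteq> s\<close>, which the inverse of \<open>act (xs @ [t])\<close> maps to nonnegative vectors by minimality on the left;
  but that inverse maps it to \<open>- \<alpha> t\<close>.
\<close>

lemma double_coset_minimal_root_pos:
  assumes min: "double_coset_minimal s t (xs @ [t])"
  shows "0 < act xs (\<alpha> t) $ s"
proof (rule ccontr)
  assume np: "\<not> 0 < act xs (\<alpha> t) $ s"
  define w where "w = xs @ [t]"
  have red: "reduced w" using min double_coset_minimal_reduced unfolding w_def by blast
  define \<beta> where "\<beta> = act xs (\<alpha> t)"
  have \<beta>: "0 \<le> \<beta> $ u" for u
    unfolding \<beta>_def using red unfolding w_def by (rule reduced_snoc_root_nonneg)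
  have \<beta>s: "\<beta> $ s = 0" using np \<beta>[of s] by (simp add: \<beta>_def)
  have pos: "0 \<le> act (rev w) (\<alpha> j) $ u" if "j \<noteq> s" for j u
  proof (rule act_root_nonneg)
    show "reduced (rev w)" using red by (rule reduced_rev)
    fix zs assume "act zs = act (rev w @ [j])"
    then have "act (rev zs) = act (j # w)" using act_rev_cong[of zs "rev w @ [j]"] by simp
    then have "act ([j] @ rev zs @ []) = act w" by (auto simp: fun_eq_iff refl_refl)
    then have "length w \<le> length (rev zs)"
      using double_coset_minimalD[OF min, of "[j]" "[]" "rev zs"] that unfolding w_def by force
    then show "length (rev w) \<le> length zs" by simp
  qed
  have "act (rev w) \<beta> = - \<alpha> t"
    unfolding w_def \<beta>_def by (simp add: act_append act_rev refl_root)
  then have "-1 = act (rev w) \<beta> $ t" by simp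
  moreover have "\<beta> = (\<Sum>j\<in>UNIV. \<beta>$j *\<^sub>R \<alpha> j)"
    by (simp add: vec_eq_iff axis_def if_distrib cong: if_cong)
  then have "act (rev w) \<beta> = act (rev w) (\<Sum>j\<in>UNIV. \<beta>$j *\<^sub>R \<alpha> j)"
    by (rule arg_cong)
  then have "act (rev w) \<beta> = (\<Sum>j\<in>UNIV. \<beta>$j *\<^sub>R act (rev w) (\<alpha> j))"
    by (simp only: act_simps(4,5))
  then have "act (rev w) \<beta> $ t = (\<Sum>j\<in>UNIV. \<beta>$j * act (rev w) (\<alpha> j) $ t)" by simp
  moreover have "0 \<le> \<beta>$j * act (rev w) (\<alpha> j) $ t" for j
    using \<beta>[of j] \<beta>s pos[of j t] by (cases "j = s") auto
  then have "0 \<le> (\<Sum>j\<in>UNIV. \<beta>$j * act (rev w) (\<alpha> j) $ t)" by (rule sum_nonneg)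
  ultimately show False by linarith
qed

end

section \<open>Products of weights in the orbits of the fundamental weights\<close>

locale level_two_coxeter = level_two_form B + coxeter_reflections B m
  for B :: "real^'s::finite^'s" and m
begin

lemma act_weight: "s \<notin> set xs \<Longrightarrow> act xs (\<omega> s) = \<omega> s"
  by (induction xs) (auto simp: refl_eq bf_root_weight)

lemma weight_in_chamber: "0 \<le> bf (\<alpha> s) (\<omega> t)"
  by (simp add: bf_root_weight)

lemma bf_act_weights: "bf (act us (\<omega> s)) (act vs (\<omega> t)) = act (rev us @ vs) (\<omega> t) $ s"
  by (simp add: bf_act_left bf_weight act_append)

lemma act_weight_decomposition:
  obtains us ys vs where "s \<notin> set us" "t \<notin> set vs" "act xs = act (us @ ys @ vs)"
    "double_coset_minimal s t ys" "act xs (\<omega> t) $ s = act ys (\<omega> t) $ s"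
proof -
  obtain us ys vs where *: "s \<notin> set us" "t \<notin> set vs" "act xs = act (us @ ys @ vs)"
    "double_coset_minimal s t ys"
    using double_coset_decomposition[of s t xs] by blast
  have "act xs (\<omega> t) $ s = bf (\<omega> s) (act us (act ys (\<omega> t)))"
    using *(2,3) by (simp add: bf_weight act_append act_weight)
  also have "\<dots> = bf (act (rev us) (\<omega> s)) (act ys (\<omega> t))"
    by (simp add: bf_act_left)
  also have "\<dots> = act ys (\<omega> t) $ s"
    using *(1) by (simp add: act_weight bf_weight)
  finally show ?thesis using that * by blast
qed

lemma act_snoc_weight: "act (xs @ [t]) (\<omega> t) = act xs (\<omega> t) - 2 *\<^sub>R act xs (\<alpha> t)"
  by (simp add: act_snoc bf_root_weight)

text \<open>An empty minimal word puts both weights on one chamber. Otherwise its innermost letter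
  is \<open>t\<close>, which subtracts twice a root with positive coordinate at \<open>s\<close>,
  while the remaining letters cannot increase that coordinate.\<close>

lemma distinct_color_pairing:
  obtains w where "act us (\<omega> s) = act w (\<omega> s)" "act vs (\<omega> t) = act w (\<omega> t)"
  | "bf (act us (\<omega> s)) (act vs (\<omega> t)) < bf (\<omega> s) (\<omega> t)"
proof -
  obtain as ys bs where *: "s \<notin> set as" "t \<notin> set bs" "act (rev us @ vs) = act (as @ ys @ bs)"
    "double_coset_minimal s t ys" "act (rev us @ vs) (\<omega> t) $ s = act ys (\<omega> t) $ s"
    by (rule act_weight_decomposition)
  show ?thesis
  proof (cases ys rule: rev_cases)
    case Nil
    have "act us (\<omega> s) = act (us @ as) (\<omega> s)" using *(1) by (simp add: act_append act_weight)
    moreover have "act vs (\<omega> t) = act (us @ as) (\<omega> t)"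
    proof -
      have "act vs (\<omega> t) = act us (act (rev us @ vs) (\<omega> t))" by (simp add: act_append act_rev)
      also have "\<dots> = act (us @ as) (\<omega> t)" unfolding *(3) using *(2) Nil by (simp add: act_append act_weight)
      finally show ?thesis .
    qed
    ultimately show ?thesis by (rule that(1))
  next
    case (snoc xs r)
    have r: "r = t" using *(4) double_coset_minimal_last unfolding snoc by blast
    have "act xs (\<omega> t) $ s \<le> \<omega> t $ s" by (rule act_chamber_le) (rule weight_in_chamber)
    moreover have "0 < act xs (\<alpha> t) $ s"
      using *(4) double_coset_minimal_root_pos unfolding snoc r by blast
    ultimately have "act ys (\<omega> t) $ s < \<omega> t $ s" unfolding snoc r act_snoc_weight by simp
    then show ?thesis using that(2) *(5) weight_sym[of s t] by (simp add: bf_act_weights bf_weight)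
  qed
qed

text \<open>The cases are minimal words of length 0, 1 and more. A longer one begins and ends with
  \<open>s\<close>: the outer letter accounts for the 2, the inner one for strictness.\<close>

lemma same_color_pairing:
  obtains "act us (\<omega> s) = act vs (\<omega> s)"
  | w where "act us (\<omega> s) = act w (\<omega> s)" "act vs (\<omega> s) = act (w @ [s]) (\<omega> s)"
  | "bf (act us (\<omega> s)) (act vs (\<omega> s)) < bf (\<omega> s) (\<omega> s) - 2"
proof -
  obtain as ys bs where *: "s \<notin> set as" "s \<notin> set bs" "act (rev us @ vs) = act (as @ ys @ bs)"
    "double_coset_minimal s s ys" "act (rev us @ vs) (\<omega> s) $ s = act ys (\<omega> s) $ s"
    by (rule act_weight_decomposition)
  have us: "act us (\<omega> s) = act (us @ as) (\<omega> s)" using *(1) by (simp add: act_append act_weight)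
  have vs: "act vs (\<omega> s) = act (us @ as @ ys) (\<omega> s)"
  proof -
    have "act vs (\<omega> s) = act us (act (rev us @ vs) (\<omega> s))" by (simp add: act_append act_rev)
    also have "\<dots> = act (us @ as @ ys) (\<omega> s)" unfolding *(3) using *(2) by (simp add: act_append act_weight)
    finally show ?thesis .
  qed
  show ?thesis
  proof (cases ys rule: rev_cases)
    case Nil
    then show ?thesis using that(1) us vs by simp
  next
    case (snoc xs r)
    have r: "r = s" using *(4) double_coset_minimal_last unfolding snoc by blast
    show ?thesis
    proof (cases xs)
      case Nil
      show ?thesis using that(2)[OF us] vs unfolding snoc r Nil by simp
    next
      case (Cons q xs')
      have q: "q = s" using *(4) double_coset_minimal_hd[of s s q "xs' @ [r]"] unfolding snoc Cons by simp
      have "reduced ([s] @ xs')"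
        using double_coset_minimal_reduced[OF *(4)] reduced_prefix[of "[s] @ xs'" "[s]"] unfolding snoc Cons q r by simp
      \<comment> \<open>The comparison starts from the prefix \<open>[s]\<close> instead of the
        empty word, and \<open>refl s (\<omega> s)\<close> has coordinate
        \<open>\<omega> s $ s - 2\<close> at \<open>s\<close>.\<close>
      from act_chamber_antimono[OF weight_in_chamber this, of s s]
      have "act xs (\<omega> s) $ s \<le> \<omega> s $ s - 2"
        unfolding Cons q by (simp add: refl_eq bf_root_weight)
      moreover have "0 < act xs (\<alpha> s) $ s"
        using *(4) double_coset_minimal_root_pos unfolding snoc r by blast
      ultimately have "act ys (\<omega> s) $ s < \<omega> s $ s - 2" unfolding snoc r act_snoc_weight by simp
      then show ?thesis using that(3) *(5) by (simp add: bf_act_weights bf_weight)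
    qed
  qed
qed

text \<open>The vector \<open>- perron\<close> lies in the chamber, so the action can only lower its
  coordinates, that is, raise those of \<open>perron\<close>.\<close>

lemma bf_weight_perron_pos: "0 < bf (act xs (\<omega> s)) perron"
proof -
  have "0 \<le> bf (\<alpha> t) (- perron)" for t
    using mult_pos_pos[OF perron_value(1) perron_pos[of t]] by (simp add: bf_simps perron_value(2))
  then have "act (rev xs) (- perron) $ s \<le> (- perron) $ s" by (rule act_chamber_le)
  then have "0 < act (rev xs) perron $ s" using perron_pos[of s] by (simp add: act_simps)
  then show ?thesis by (simp add: bf_act_left bf_weight)
qed

text \<open>
  Every weight pairs positively with the Perron vector, so proportional weights are positively
  proportional; the fundamental domain then forces them to be equal.
\<close>

lemma proj_weight_inj:
  assumes "proj (act us (\<omega> s)) = proj (act vs (\<omega> t))"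
  shows "s = t" "act us (\<omega> s) = act vs (\<omega> t)"
proof -
  have "act us (\<omega> s) \<in> span {act vs (\<omega> t)}"
    using assms span_base[of "act us (\<omega> s)" "{act us (\<omega> s)}"] unfolding proj_def by simp
  then obtain k where k: "act us (\<omega> s) = k *\<^sub>R act vs (\<omega> t)" by (auto simp: span_singleton)
  have "0 < k * bf (act vs (\<omega> t)) perron"
    using bf_weight_perron_pos[of us s] unfolding k by (simp add: bf_simps)
  then have k0: "0 < k" using bf_weight_perron_pos[of vs t] by (simp add: zero_less_mult_iff)
  have "act (rev vs @ us) (\<omega> s) = k *\<^sub>R \<omega> t" by (simp add: act_append k act_simps act_rev)
  moreover have "act (rev vs @ us) (\<omega> s) = \<omega> s"
  proof (rule fundamental_domain)
    show "0 \<le> bf (\<alpha> r) (\<omega> s)" for r by (rule weight_in_chamber)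
    show "0 \<le> bf (\<alpha> r) (act (rev vs @ us) (\<omega> s))" for r
      using k0 calculation weight_in_chamber[of r t] by (simp add: bf_simps)
  qed
  ultimately have e: "\<omega> s = k *\<^sub>R \<omega> t" by simp
  have "bf (\<alpha> s) (\<omega> s) = bf (\<alpha> s) (k *\<^sub>R \<omega> t)" using e by (rule arg_cong)
  then have "1 = k * (if s = t then 1 else 0)" by (simp only: bf_simps bf_root_weight real_scaleR_def simp_thms if_True)
  then show "s = t" "act us (\<omega> s) = act vs (\<omega> t)" using k by (auto split: if_splits)
qed

end

section \<open>Balls in the light sphere\<close>

text \<open>The leading and constant coefficients have opposite signs, so exactly one root is
  positive. The last conclusion holds because \<open>r * a + b\<close> is the square root of the
  reduced discriminant; it decides on which side of a hyperplane a constructed null vector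
  lies.\<close>

lemma quadratic_root:
  fixes a b k :: real
  assumes "0 < a" "k < 0"
  obtains r where "0 < r" "k + 2 * r * b + r\<^sup>2 * a = 0" "0 < r * a + b"
proof -
  define D where "D = sqrt (b\<^sup>2 - a * k)"
  have ak: "a * k < 0" using assms by (rule mult_pos_neg)
  then have D2: "D\<^sup>2 = b\<^sup>2 - a * k" unfolding D_def by (subst real_sqrt_pow2) (auto simp: add_nonneg_nonneg intro: order_trans[OF _ zero_le_power2])
  have "sqrt (b\<^sup>2) < D" unfolding D_def using ak by (subst real_sqrt_less_iff) simp
  then have D: "\<bar>b\<bar> < D" by simp
  define r where "r = (D - b) / a"
  have ra: "r * a = D - b" using assms by (simp add: r_def)
  have "a * (k + 2 * r * b + r\<^sup>2 * a) = a * k + 2 * (r * a) * b + (r * a)\<^sup>2"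
    by (simp add: algebra_simps power2_eq_square)
  also have "\<dots> = 0" unfolding ra using D2 by (simp add: power2_eq_square algebra_simps)
  finally have root: "k + 2 * r * b + r\<^sup>2 * a = 0" using assms by simp
  have "0 < r" using D assms by (simp add: r_def)
  moreover note root
  moreover have "0 < r * a + b" unfolding ra using D by simp
  ultimately show ?thesis by (rule that)
qed

lemma proj_eqD:
  assumes "proj y = proj z" obtains k where "y = k *\<^sub>R z"
proof -
  have "y \<in> span {z}" using assms span_base[of y "{y}"] unfolding proj_def by simp
  then show ?thesis using that by (auto simp: span_singleton)
qed

lemma proj_scaleR: assumes "k \<noteq> 0" shows "proj (k *\<^sub>R y) = proj y"
  unfolding proj_def
  by (rule span_image_scale[of "{y}" "\<lambda>_. k", simplified]) (use assms in simp)

lemma topspace_proj_topology: "topspace (proj_topology :: (real^'s::finite) set topology) = proj_space"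
proof
  show "topspace (proj_topology :: (real^'s) set topology) \<subseteq> proj_space"
    using openin_topspace[of "proj_topology :: (real^'s) set topology"] unfolding openin_proj_topology by blast
  have "{x::real^'s. x \<noteq> 0 \<and> proj x \<in> proj_space} = - {0}" by (auto simp: proj_space_def)
  then have "openin proj_topology (proj_space :: (real^'s) set set)" unfolding openin_proj_topology by auto
  then show "proj_space \<subseteq> topspace (proj_topology :: (real^'s) set topology)" by (rule openin_subset)
qed

locale level_two_balls = level_two_form B for B :: "real^'s::finite^'s" +
  fixes c :: "real^'s"
  assumes c_pos: "0 < c $ s" and avoids: "avoids_light_cone B c"
begin

text \<open>The height form and \<open>perron\<close> pick the same half of the light cone. If they
  disagreed on \<open>y\<close>, the kernel of the height form would contain a timelike combination
  \<open>v\<close> of \<open>perron\<close> and \<open>y\<close>; moving it in a spacelike direction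
  inside the kernel reaches a nonzero null vector, which is excluded.\<close>

lemma null_height_pos:
  assumes y: "bf y y = 0" "0 < c \<bullet> y"
  shows "0 < y \<bullet> perron"
proof (rule ccontr)
  assume np: "\<not> 0 < y \<bullet> perron"
  have "y \<noteq> 0" using y by auto
  then have "y \<bullet> perron \<noteq> 0" using pos_def_perp[of y] y by auto
  then have neg: "y \<bullet> perron < 0" using np by simp
  have cp: "0 < c \<bullet> perron"
    unfolding inner_vec_def using c_pos perron_pos by (auto intro!: sum_pos)
  define t where "t = (c \<bullet> perron) / (c \<bullet> y)"
  have t: "0 < t" using cp y by (simp add: t_def)
  define v where "v = perron - t *\<^sub>R y"
  have cv: "c \<bullet> v = 0" using y by (simp add: v_def t_def inner_simps)
  have vp: "0 < v \<bullet> perron"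
  proof -
    have "t * (y \<bullet> perron) < 0" using t neg by (rule mult_pos_neg)
    then show ?thesis using perron_nonzero by (simp add: v_def inner_simps less_trans)
  qed
  have "bf y perron > 0" using neg perron_value(1) by (simp add: bf_perron mult_pos_neg)
  then have vv: "bf v v < 0"
    using perron_timelike y(1) mult_pos_pos[OF t \<open>bf y perron > 0\<close>]
    by (simp add: v_def bf_simps bf_commute[of perron y])
  \<comment> \<open>Dimension at least three leaves a direction \<open>e\<close> perpendicular to
    both, so adding multiples of \<open>e\<close> changes neither height nor time.\<close>
  have "dim {perron, c} \<le> card {perron, c}" by (rule dim_le_card') simp
  also have "\<dots> \<le> 2" by (simp add: card_insert_if)
  also have "\<dots> < DIM(real^'s)" using rank_ge_3 by simp
  finally obtain e where e: "e \<noteq> 0" "\<And>x. x \<in> span {perron, c} \<Longrightarrow> orthogonal e x"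
    using orthogonal_to_subspace_exists[of "{perron, c}"] by blast
  have ep: "e \<bullet> perron = 0" "c \<bullet> e = 0"
    using e(2)[of perron] e(2)[of c] by (auto simp: orthogonal_def span_base inner_commute)
  from pos_def_perp[OF ep(1) e(1)] have ee: "0 < bf e e" .
  obtain r where r: "bf v v + 2 * r * bf v e + r\<^sup>2 * bf e e = 0"
    using quadratic_root[OF ee vv] by blast
  define n where "n = v + r *\<^sub>R e"
  have "bf n n = 0" using r by (simp add: n_def bf_simps bf_commute[of e v] power2_eq_square algebra_simps)
  moreover have "c \<bullet> n = 0" using cv ep by (simp add: n_def inner_simps)
  ultimately have "n = 0" using avoids unfolding avoids_light_cone_def light_cone_def by simp
  moreover have "0 < n \<bullet> perron" using vp ep by (simp add: n_def inner_simps)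
  ultimately show False by simp
qed

lemma null_perron_height:
  assumes y: "bf y y = 0" "0 < y \<bullet> perron"
  shows "0 < c \<bullet> y"
proof (rule ccontr)
  assume "\<not> 0 < c \<bullet> y"
  moreover have "c \<bullet> y \<noteq> 0"
    using avoids y unfolding avoids_light_cone_def light_cone_def by auto
  ultimately have "0 < c \<bullet> (- y)" by simp
  moreover have "bf (- y) (- y) = 0" using y by (simp add: bf_simps)
  ultimately have "0 < (- y) \<bullet> perron" using null_height_pos by blast
  then show False using y by simp
qed

section \<open>Topology of the light sphere and of the balls\<close>

definition future_cone :: "(real^'s) set" where
  "future_cone = {y. bf y y = 0 \<and> 0 < c \<bullet> y}"

lemma proj_future_eqD:
  assumes "y \<in> future_cone" "z \<in> future_cone" "proj y = proj z"
  obtains k where "0 < k" "y = k *\<^sub>R z"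
proof -
  obtain k where k: "y = k *\<^sub>R z" using proj_eqD[OF assms(3)] .
  then have "0 < k" using assms by (simp add: future_cone_def zero_less_mult_iff)
  then show ?thesis using k that by blast
qed

lemma topspace_light_sphere: "topspace (light_sphere B) = proj ` future_cone"
proof -
  have "proj ` (light_cone B - {0}) \<subseteq> proj_space" by (auto simp: proj_space_def)
  then have "topspace (light_sphere B) = proj ` (light_cone B - {0})"
    by (auto simp: light_sphere_def topspace_proj_topology)
  also have "\<dots> = proj ` future_cone"
  proof (intro equalityI subsetI)
    fix l assume "l \<in> proj ` (light_cone B - {0})"
    then obtain y where y: "l = proj y" "bf y y = 0" "y \<noteq> 0" by (auto simp: light_cone_def)
    have "c \<bullet> y \<noteq> 0" using avoids y unfolding avoids_light_cone_def light_cone_def by auto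
    then have "0 < c \<bullet> y \<or> 0 < c \<bullet> ((-1) *\<^sub>R y)" by auto
    moreover have "bf ((-1) *\<^sub>R y) ((-1) *\<^sub>R y) = 0" using y(2) by (simp add: bf_simps)
    ultimately consider "y \<in> future_cone" | "(-1) *\<^sub>R y \<in> future_cone"
      using y(2) unfolding future_cone_def by blast
    then show "l \<in> proj ` future_cone"
    proof cases
      case 1
      then show ?thesis using y(1) by blast
    next
      case 2
      have "l = proj ((-1) *\<^sub>R y)" using y(1) proj_scaleR[of "-1" y] by simp
      then show ?thesis using 2 by (rule image_eqI)
    qed
  next
    have "future_cone \<subseteq> light_cone B - {0}" by (auto simp: future_cone_def light_cone_def)
    then show "l \<in> proj ` (light_cone B - {0})" if "l \<in> proj ` future_cone" for l
      using that by blast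
  qed
  finally show ?thesis .
qed

text \<open>The product \<open>(c \<bullet> y) * bf x y\<close> is even in \<open>y\<close>, so its
  sign is well defined on lines; on null lines its positivity selects the future representatives
  with \<open>0 < bf x y\<close>.\<close>

lemma openin_half: "openin (light_sphere B) (proj ` {y \<in> future_cone. 0 < bf x y})"
proof -
  define T where "T = proj ` {y. 0 < (c \<bullet> y) * bf x y}"
  have eq: "{z. z \<noteq> 0 \<and> proj z \<in> T} = {z. 0 < (c \<bullet> z) * bf x z}"
  proof (intro equalityI subsetI)
    fix z assume "z \<in> {z. z \<noteq> 0 \<and> proj z \<in> T}"
    then obtain y where y: "z \<noteq> 0" "proj z = proj y" "0 < (c \<bullet> y) * bf x y" by (auto simp: T_def)
    then obtain k where k: "z = k *\<^sub>R y" using proj_eqD by blast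
    then have "(c \<bullet> z) * bf x z = k\<^sup>2 * ((c \<bullet> y) * bf x y)" by (simp add: bf_simps power2_eq_square)
    moreover have "k \<noteq> 0" using k y by auto
    ultimately show "z \<in> {z. 0 < (c \<bullet> z) * bf x z}" using y(3) by simp
  qed (auto simp: T_def)
  have "open {z. 0 < (c \<bullet> z) * bf x z}"
    by (intro open_Collect_less continuous_on_mult continuous_on_inner continuous_bf
        continuous_on_const continuous_on_id)
  moreover have "T \<subseteq> proj_space" unfolding T_def proj_space_def by (intro image_mono) auto
  ultimately have T: "openin proj_topology T" unfolding openin_proj_topology eq by (rule conjI[rotated])
  have "proj ` {y \<in> future_cone. 0 < bf x y} = T \<inter> proj ` (light_cone B - {0})"
  proof (intro equalityI subsetI)
    fix l assume "l \<in> T \<inter> proj ` (light_cone B - {0})"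
    then have l: "l \<in> T" "l \<in> proj ` (light_cone B - {0})" by blast+
    obtain y where y: "l = proj y" "0 < (c \<bullet> y) * bf x y" using l(1) unfolding T_def by blast
    obtain z where z: "l = proj z" "bf z z = 0" using l(2) unfolding light_cone_def by blast
    note yz = y z
    have "proj y = proj z" using yz by simp
    then obtain k where "y = k *\<^sub>R z" by (rule proj_eqD)
    then have yy: "bf y y = 0" using yz by (simp add: bf_simps)
    consider "0 < c \<bullet> y" "0 < bf x y" | "0 < c \<bullet> ((-1) *\<^sub>R y)" "0 < bf x ((-1) *\<^sub>R y)"
      using yz(2) by (auto simp: zero_less_mult_iff bf_simps)
    then show "l \<in> proj ` {y \<in> future_cone. 0 < bf x y}"
    proof cases
      case 1
      then show ?thesis using yz(1) yy by (auto simp: future_cone_def)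
    next
      case 2
      have "bf ((-1) *\<^sub>R y) ((-1) *\<^sub>R y) = 0" using yy by (simp only: bf_simps) simp
      then have "(-1) *\<^sub>R y \<in> {y \<in> future_cone. 0 < bf x y}" using 2 unfolding future_cone_def by blast
      moreover have "l = proj ((-1) *\<^sub>R y)" using yz(1) proj_scaleR[of "-1" y] by simp
      ultimately show ?thesis by blast
    qed
  next
    fix l assume "l \<in> proj ` {y \<in> future_cone. 0 < bf x y}"
    then obtain y where y: "l = proj y" "y \<in> future_cone" "0 < bf x y" by blast
    then have "y \<in> {y. 0 < (c \<bullet> y) * bf x y}" "y \<in> light_cone B - {0}"
      by (auto simp: future_cone_def light_cone_def)
    then show "l \<in> T \<inter> proj ` (light_cone B - {0})"
      unfolding T_def y(1) by blast
  qed
  then show ?thesis unfolding light_sphere_def openin_subtopology using T by blast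
qed

lemma ball_of_eq: "ball_of B c x = proj ` {y \<in> future_cone. bf x y \<le> 0}"
  by (auto simp: ball_of_def future_cone_def light_cone_def)

text \<open>A point of the light sphere fixes its future representative up to a positive factor, so
  any condition on the sign of \<open>bf x y\<close> makes sense there. An arbitrary
  \<open>P\<close> treats open half, closed half and boundary at once.\<close>

lemma proj_future_cut_iff:
  assumes "y \<in> future_cone"
  shows "proj y \<in> proj ` {z \<in> future_cone. P (sgn (bf x z))} \<longleftrightarrow> P (sgn (bf x y))"
proof
  assume "proj y \<in> proj ` {z \<in> future_cone. P (sgn (bf x z))}"
  then obtain z where z: "z \<in> future_cone" "P (sgn (bf x z))" "proj y = proj z" by blast
  obtain k where "0 < k" "y = k *\<^sub>R z" using proj_future_eqD[OF assms z(1,3)] .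
  then show "P (sgn (bf x y))" using z by (simp add: bf_simps sgn_mult)
qed (use assms in blast)

lemma proj_future_cut_diff:
  "proj ` {z \<in> future_cone. P (sgn (bf x z))} - proj ` {z \<in> future_cone. Q (sgn (bf x z))}
     = proj ` {z \<in> future_cone. P (sgn (bf x z)) \<and> \<not> Q (sgn (bf x z))}" (is "?L = ?R")
proof (intro equalityI subsetI)
  fix l assume "l \<in> ?L"
  then obtain y where "l = proj y" "y \<in> future_cone" "P (sgn (bf x y))"
    "proj y \<notin> proj ` {z \<in> future_cone. Q (sgn (bf x z))}" by blast
  then show "l \<in> ?R" using proj_future_cut_iff[of y Q x] by blast
next
  fix l assume "l \<in> ?R"
  then obtain y where "l = proj y" "y \<in> future_cone" "P (sgn (bf x y))" "\<not> Q (sgn (bf x y))" by blast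
  then show "l \<in> ?L" using proj_future_cut_iff[of y Q x] by blast
qed

lemmas proj_future_le_iff = proj_future_cut_iff[where P = "\<lambda>r. r \<le> 0", simplified]
lemmas proj_future_less_iff = proj_future_cut_iff[where P = "\<lambda>r. r < 0", simplified]

lemma closedin_ball: "closedin (light_sphere B) (ball_of B c x)"
proof -
  have "topspace (light_sphere B) - ball_of B c x = proj ` {y \<in> future_cone. 0 < bf x y}"
    unfolding topspace_light_sphere ball_of_eq
    using proj_future_cut_diff[of "\<lambda>_. True" x "\<lambda>r. r \<le> 0"] by (simp add: not_le)
  then show ?thesis
    unfolding closedin_def using openin_half[of x] by (auto simp: topspace_light_sphere ball_of_eq)
qed

text \<open>
  A point \<open>y\<close> of the bounding hyperplane is a limit of null vectors outside the ball: reflect \<open>y\<close> in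
  \<open>x + \<epsilon> \<cdot> perron\<close> and let \<open>\<epsilon> \<rightarrow> 0\<close>.
\<close>

lemma boundary_approx:
  assumes x: "0 < bf x x" and y: "y \<in> future_cone" "bf x y = 0"
    and U: "open U" "y \<in> U"
  shows "\<exists>z\<in>U. z \<in> future_cone \<and> 0 < bf x z"
proof -
  define d where "d e = x + e *\<^sub>R perron" for e
  define g where "g e = y - (2 * bf y (d e) / bf (d e) (d e)) *\<^sub>R d e" for e
  have d0: "d 0 = x" and g0: "g 0 = y" using y(2) by (simp_all add: d_def g_def bf_commute[of y x])
  have td: "(d \<longlongrightarrow> x) (at_right 0)" unfolding d_def by (auto intro!: tendsto_eq_intros)
  have bfd: "bf u (d e) = bf u x + e * bf u perron" for u e by (simp add: d_def bf_simps)
  have bdd: "bf (d e) (d e) = bf x x + 2 * e * bf x perron + e\<^sup>2 * bf perron perron" for e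
    by (simp add: d_def bf_simps bf_commute[of perron x] power2_eq_square algebra_simps)
  have t1: "((\<lambda>e. bf (d e) (d e)) \<longlongrightarrow> bf x x) (at_right 0)"
    unfolding bdd by (auto intro!: tendsto_eq_intros)
  have t2: "((\<lambda>e. bf x (d e)) \<longlongrightarrow> bf x x) (at_right 0)"
    unfolding bfd by (auto intro!: tendsto_eq_intros)
  have t3: "((\<lambda>e. bf y (d e)) \<longlongrightarrow> 0) (at_right 0)"
    unfolding bfd using y(2) by (auto intro!: tendsto_eq_intros simp: bf_commute[of y x])
  have "((\<lambda>e. 2 * bf y (d e) / bf (d e) (d e)) \<longlongrightarrow> 2 * 0 / bf x x) (at_right 0)"
    using x by (intro tendsto_divide tendsto_mult tendsto_const t1 t3) simp
  then have "(g \<longlongrightarrow> y - (2 * 0 / bf x x) *\<^sub>R x) (at_right 0)"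
    unfolding g_def by (intro tendsto_diff tendsto_scaleR tendsto_const td)
  then have tg: "(g \<longlongrightarrow> y) (at_right 0)" by simp
  have "((\<lambda>e. c \<bullet> g e) \<longlongrightarrow> c \<bullet> y) (at_right 0)" by (intro tendsto_intros tg)
  then have "\<forall>\<^sub>F e in at_right 0. 0 < c \<bullet> g e"
    using y(1) by (intro order_tendstoD(1)) (auto simp: future_cone_def)
  moreover have "\<forall>\<^sub>F e in at_right 0. 0 < bf (d e) (d e)" using t1 x by (rule order_tendstoD(1))
  moreover have "\<forall>\<^sub>F e in at_right 0. 0 < bf x (d e)" using t2 x by (rule order_tendstoD(1))
  moreover have "\<forall>\<^sub>F e in at_right 0. g e \<in> U" using tg U by (rule topological_tendstoD)
  moreover have "\<forall>\<^sub>F e in at_right (0::real). 0 < e" by (rule eventually_at_right_less)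
  ultimately have "\<forall>\<^sub>F e in at_right 0. 0 < c \<bullet> g e \<and> 0 < bf (d e) (d e) \<and> 0 < bf x (d e) \<and> g e \<in> U \<and> 0 < e"
    by eventually_elim blast
  from eventually_happens'[OF trivial_limit_at_right_real this]
  obtain e where e: "0 < c \<bullet> g e" "0 < bf (d e) (d e)" "0 < bf x (d e)" "g e \<in> U" "0 < e"
    by blast
  define q where "q = 2 * bf y (d e) / bf (d e) (d e)"
  have q: "q * bf (d e) (d e) = 2 * bf y (d e)" using e(2) by (simp add: q_def)
  have "bf (g e) (g e) = bf y y - 2 * q * bf y (d e) + q * (q * bf (d e) (d e))"
    unfolding g_def q_def[symmetric] by (simp add: bf_simps bf_commute[of "d e" y] algebra_simps)
  also have "\<dots> = 0" unfolding q using y(1) by (simp add: future_cone_def)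
  finally have "g e \<in> future_cone" using e(1) by (simp add: future_cone_def)
  \<comment> \<open>Future null vectors pair negatively with \<open>perron\<close>. Tilting the
    mirror from \<open>x\<close> towards \<open>perron\<close> therefore makes \<open>q\<close>
    negative, and the reflection pushes \<open>y\<close> out of the ball.\<close>
  moreover have "0 < bf x (g e)"
  proof -
    have "0 < y \<bullet> perron" using null_height_pos y(1) by (simp add: future_cone_def)
    then have "bf y perron < 0" using perron_value(1) by (simp add: bf_perron)
    then have "bf y (d e) < 0" using e(5) y(2) by (simp add: bfd bf_commute[of y x] mult_pos_neg)
    then have "q < 0" using e(2) by (simp add: q_def divide_neg_pos)
    then have "q * bf x (d e) < 0" using e(3) by (rule mult_neg_pos)
    then show ?thesis unfolding g_def q_def[symmetric] using y(2) by (simp add: bf_simps)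
  qed
  ultimately show ?thesis using e(4) by blast
qed

text \<open>The strict half is open by \<open>openin_half\<close> for \<open>- x\<close>; conversely
  every neighborhood of a boundary point meets the outside by
  \<open>boundary_approx\<close>.\<close>

lemma interior_ball:
  assumes x: "0 < bf x x"
  shows "light_sphere B interior_of ball_of B c x = proj ` {y \<in> future_cone. bf x y < 0}" (is "?I = ?R")
proof
  have "openin (light_sphere B) ?R" using openin_half[of "- x"] by (simp add: bf_simps)
  moreover have "?R \<subseteq> ball_of B c x" by (auto simp: ball_of_eq)
  ultimately show "?R \<subseteq> ?I" by (rule interior_of_maximal[rotated])
  show "?I \<subseteq> ?R"
  proof
    fix l assume l: "l \<in> ?I"
    then obtain y where y: "l = proj y" "y \<in> future_cone" "bf x y \<le> 0"
      using interior_of_subset[of "light_sphere B" "ball_of B c x"] by (auto simp: ball_of_eq)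
    have "bf x y \<noteq> 0"
    proof
      assume 0: "bf x y = 0"
      obtain T where T: "openin proj_topology T" "?I = T \<inter> proj ` (light_cone B - {0})"
        using openin_interior_of[of "light_sphere B" "ball_of B c x"]
        unfolding light_sphere_def openin_subtopology by blast
      have "open {z. z \<noteq> 0 \<and> proj z \<in> T}" using T(1) unfolding openin_proj_topology by blast
      moreover have "y \<in> {z. z \<noteq> 0 \<and> proj z \<in> T}"
        using l y(1,2) T(2) by (auto simp: future_cone_def)
      ultimately obtain z where z: "z \<noteq> 0" "proj z \<in> T" "z \<in> future_cone" "0 < bf x z"
        using boundary_approx[OF x y(2) 0] by blast
      then have "proj z \<in> ?I" unfolding T(2) by (auto simp: future_cone_def light_cone_def)
      then have "proj z \<in> ball_of B c x" using interior_of_subset by (rule subsetD[rotated])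
      then show False using z(3,4) by (simp add: ball_of_eq proj_future_le_iff)
    qed
    then show "l \<in> ?R" using y by auto
  qed
qed

lemma frontier_ball:
  assumes x: "0 < bf x x"
  shows "light_sphere B frontier_of ball_of B c x = proj ` {y \<in> future_cone. bf x y = 0}"
  unfolding frontier_of_def closure_of_closedin[OF closedin_ball] interior_ball[OF x]
  unfolding ball_of_eq
  using proj_future_cut_diff[of "\<lambda>r. r \<le> 0" x "\<lambda>r. r < 0"] by (simp add: not_less order_eq_iff)

text \<open>Moving from \<open>perron\<close> against \<open>x\<close> until the norm vanishes gives
  an interior point. Disjoint interiors then imply that the balls are distinct.\<close>

lemma interior_ball_nonempty:
  assumes x: "0 < bf x x" "0 < bf x perron"
  shows "light_sphere B interior_of ball_of B c x \<noteq> {}"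
proof -
  obtain r where r: "0 < r" "bf perron perron + 2 * r * (- bf x perron) + r\<^sup>2 * bf x x = 0"
    "0 < r * bf x x + (- bf x perron)"
    using quadratic_root[OF x(1) perron_timelike] .
  define y where "y = perron - r *\<^sub>R x"
  have yy: "bf y y = 0"
    using r(2) by (simp add: y_def bf_simps bf_commute[of perron x] power2_eq_square algebra_simps)
  have "x \<bullet> perron < 0" using x(2) perron_value(1) by (simp add: bf_perron mult_less_0_iff)
  then have "r * (x \<bullet> perron) < 0" using r(1) by (rule mult_pos_neg[rotated])
  then have "0 < y \<bullet> perron" using perron_nonzero by (simp add: y_def inner_simps less_trans)
  then have "y \<in> future_cone" using null_perron_height yy by (simp add: future_cone_def)
  moreover have "bf x y < 0" using r(3) by (simp add: y_def bf_simps)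
  ultimately show ?thesis unfolding interior_ball[OF x(1)] by blast
qed

lemma ball_pair:
  assumes x: "0 < bf x x" "0 < bf x perron" and y: "0 < bf y y" "0 < bf y perron"
    and xy: "bf x y \<le> - sqrt (bf x x * bf y y)"
  shows "light_sphere B interior_of ball_of B c x \<inter> light_sphere B interior_of ball_of B c y = {}"
    and "ball_of B c x \<noteq> ball_of B c y"
    and "tangent B (ball_of B c x) (ball_of B c y) \<longleftrightarrow> bf x y = - sqrt (bf x x * bf y y)"
proof -
  define a b where "a = sqrt (bf x x)" and "b = sqrt (bf y y)"
  have ab: "0 < a" "0 < b" "a * a = bf x x" "b * b = bf y y" using x y by (simp_all add: a_def b_def)
  have sq: "sqrt (bf x x * bf y y) = a * b" by (simp add: a_def b_def real_sqrt_mult)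
  \<comment> \<open>A positive multiple of minus the sum of the normalized vectors, which points to
    the future. It is causal since the normalized product is at most -1, so no future null
    \<open>v\<close> pairs negatively with both \<open>x\<close> and \<open>y\<close>. It is null
    exactly at equality, and is then the point of contact.\<close>
  define z where "z = - (b *\<^sub>R x + a *\<^sub>R y)"
  have zz: "bf z z = 2 * (a * b) * (a * b + bf x y)"
    by (simp add: z_def bf_simps bf_commute[of y x] algebra_simps flip: ab(3,4))
  have z1: "bf z z \<le> 0" unfolding zz using ab(1,2) xy sq by (intro mult_nonneg_nonpos) auto
  have "0 < b * bf x perron + a * bf y perron" using ab x y by (simp add: add_pos_pos)
  then have "bf z perron < 0" by (simp add: z_def bf_simps)
  then have z2: "0 < z \<bullet> perron" using perron_value(1) by (simp add: bf_perron zero_less_mult_iff)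
  have zf: "bf z v \<le> 0 \<and> (bf z v = 0 \<longrightarrow> bf z z = 0)" if "v \<in> future_cone" for v
    using causal_opposite[OF z1 _ z2, of v] null_height_pos[of v] that by (simp add: future_cone_def)
  have bzv: "bf z v = - (b * bf x v + a * bf y v)" for v by (simp add: z_def bf_simps)
  show disj: "light_sphere B interior_of ball_of B c x \<inter> light_sphere B interior_of ball_of B c y = {}"
    unfolding interior_ball[OF x(1)] interior_ball[OF y(1)]
  proof (rule ccontr)
    assume "proj ` {v \<in> future_cone. bf x v < 0} \<inter> proj ` {v \<in> future_cone. bf y v < 0} \<noteq> {}"
    then obtain v where v: "v \<in> future_cone" "bf x v < 0" "proj v \<in> proj ` {v \<in> future_cone. bf y v < 0}"
      by blast
    from v(3) have yv: "bf y v < 0" unfolding proj_future_less_iff[OF v(1)] .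
    then have "b * bf x v + a * bf y v < 0" using ab v(2) by (simp add: add_neg_neg mult_pos_neg)
    then show False using zf[OF v(1)] bzv[of v] by simp
  qed
  show "ball_of B c x \<noteq> ball_of B c y"
    using disj interior_ball_nonempty[OF x] by auto
  have "light_sphere B frontier_of ball_of B c x \<inter> light_sphere B frontier_of ball_of B c y \<noteq> {}
    \<longleftrightarrow> bf x y = - sqrt (bf x x * bf y y)" (is "?L \<longleftrightarrow> ?R")
    unfolding frontier_ball[OF x(1)] frontier_ball[OF y(1)]
  proof
    assume "proj ` {v \<in> future_cone. bf x v = 0} \<inter> proj ` {v \<in> future_cone. bf y v = 0} \<noteq> {}"
    then obtain v where v: "v \<in> future_cone" "bf x v = 0" "proj v \<in> proj ` {v \<in> future_cone. bf y v = 0}"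
      by blast
    then have "bf y v = 0" using proj_future_cut_iff[OF v(1), of "\<lambda>r. r = 0" y] by (simp add: sgn_eq_0_iff)
    then have "bf z z = 0" using zf[OF v(1)] bzv[of v] v(2) by simp
    then show ?R unfolding zz sq using ab by simp
  next
    assume R: ?R
    then have "bf z z = 0" unfolding zz sq by simp
    then have z: "z \<in> future_cone" using null_perron_height z2 by (simp add: future_cone_def)
    have "bf x z = 0" using R unfolding sq by (simp add: z_def bf_simps flip: ab(3))
    moreover have "bf y z = 0" using R unfolding sq by (simp add: z_def bf_simps bf_commute[of y x] flip: ab(4))
    ultimately show "proj ` {v \<in> future_cone. bf x v = 0} \<inter> proj ` {v \<in> future_cone. bf y v = 0} \<noteq> {}"
      using z by blast
  qed
  then show "tangent B (ball_of B c x) (ball_of B c y) \<longleftrightarrow> bf x y = - sqrt (bf x x * bf y y)"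
    using disj by (simp add: tangent_def)
qed

end

section \<open>The Coxeter complex and the tangency graph\<close>

text \<open>Orbits and chambers depend on the group only through the set of linear maps by which it
  acts, so words can replace group elements.\<close>

locale coxeter_packing = level_two_coxeter B m + level_two_balls B c
  for B :: "real^'s::finite^'s" and m and c +
  fixes G :: "('g, 'b) monoid_scheme" and \<phi> :: "'g \<Rightarrow> real^'s \<Rightarrow> real^'s"
  assumes action_image: "\<phi> ` carrier G = range act"
begin

abbreviation vertex :: "'s list \<Rightarrow> 's \<Rightarrow> (real^'s) set" where "vertex xs s \<equiv> proj (act xs (\<omega> s))"

lemma vertex_eq_iff: "vertex us s = vertex vs t \<longleftrightarrow> s = t \<and> act us (\<omega> s) = act vs (\<omega> t)"
  using proj_weight_inj[of us s vs t] by auto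

lemma orbit_eq: "orbit G \<phi> x = range (\<lambda>xs. act xs x)"
proof -
  have "orbit G \<phi> x = (\<lambda>f. f x) ` (\<phi> ` carrier G)" by (auto simp: orbit_def)
  then show ?thesis unfolding action_image by (simp add: image_image)
qed

lemma chambers_eq: "chambers G \<phi> B = range (\<lambda>xs. range (vertex xs))"
proof -
  have "chambers G \<phi> B = (\<lambda>f. range (\<lambda>s. proj (f (\<omega> s)))) ` (\<phi> ` carrier G)"
    by (simp add: chambers_def fundamental_weights_def image_image)
  then show ?thesis unfolding action_image by (simp add: image_image)
qed

lemma vertices_eq: "vertices G \<phi> B = (\<Union>s. range (\<lambda>xs. vertex xs s))"
  unfolding vertices_def coxeter_complex_def chambers_eq by blast

lemma color_vertex: "color G \<phi> B (vertex xs s) = \<omega> s"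
  unfolding color_def
proof (rule the_equality)
  show "\<omega> s \<in> fundamental_weights B \<and> vertex xs s \<in> proj ` orbit G \<phi> (\<omega> s)"
    by (auto simp: fundamental_weights_def orbit_eq)
  fix x assume "x \<in> fundamental_weights B \<and> vertex xs s \<in> proj ` orbit G \<phi> x"
  then obtain t ys where x: "x = \<omega> t" "vertex xs s = vertex ys t"
    by (auto simp: fundamental_weights_def orbit_eq)
  then show "x = \<omega> s" using proj_weight_inj(1) by blast
qed

lemma real_vertices_eq: "real_vertices G \<phi> B = {vertex xs s | xs s. 0 < \<omega> s $ s}"
proof -
  have "v \<in> real_vertices G \<phi> B \<longleftrightarrow> (\<exists>xs s. v = vertex xs s \<and> 0 < \<omega> s $ s)" for v
  proof
    assume v: "v \<in> real_vertices G \<phi> B"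
    then obtain xs s where e: "v = vertex xs s" unfolding real_vertices_def vertices_eq by blast
    then show "\<exists>xs s. v = vertex xs s \<and> 0 < \<omega> s $ s"
      using v by (auto simp: real_vertices_def color_vertex spacelike_def bf_weight)
  next
    assume "\<exists>xs s. v = vertex xs s \<and> 0 < \<omega> s $ s"
    then obtain xs s where e: "v = vertex xs s" "0 < \<omega> s $ s" by blast
    then show "v \<in> real_vertices G \<phi> B"
      unfolding real_vertices_def vertices_eq by (auto simp: color_vertex spacelike_def bf_weight)
  qed
  then show ?thesis by blast
qed

lemma bf_act_weight_self: "bf (act xs (\<omega> s)) (act xs (\<omega> t)) = \<omega> s $ t"
  by (simp add: bf_act bf_weight)

lemma real_weights_eq: "real_weights G \<phi> B = {act xs (\<omega> s) | xs s. 0 < \<omega> s $ s}"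
proof -
  have w: "x \<in> weights G \<phi> B \<longleftrightarrow> (\<exists>xs s. x = act xs (\<omega> s))" for x
    unfolding weights_def fundamental_weights_def orbit_eq by auto
  have "x \<in> real_weights G \<phi> B \<longleftrightarrow> (\<exists>xs s. x = act xs (\<omega> s) \<and> 0 < bf x x)" for x
    unfolding real_weights_def mem_Collect_eq w spacelike_def by blast
  also have "\<dots> x \<longleftrightarrow> (\<exists>xs s. x = act xs (\<omega> s) \<and> 0 < \<omega> s $ s)" for x
    using bf_act_weight_self by metis
  finally show ?thesis by blast
qed

lemma inj_on_proj_weights: "inj_on proj (real_weights G \<phi> B)"
  unfolding real_weights_eq by (auto intro!: inj_onI simp: vertex_eq_iff)

lemma proj_real_weights: "proj ` real_weights G \<phi> B = real_vertices G \<phi> B"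
  unfolding real_weights_eq real_vertices_eq by blast

lemma complex_edge_vertex_iff:
  "complex_edge G \<phi> B (vertex us s) (vertex vs t) \<longleftrightarrow>
     s \<noteq> t \<and> (\<exists>w. act us (\<omega> s) = act w (\<omega> s) \<and> act vs (\<omega> t) = act w (\<omega> t))"
proof
  assume "complex_edge G \<phi> B (vertex us s) (vertex vs t)"
  then obtain D where ne: "vertex us s \<noteq> vertex vs t"
    and D: "D \<in> chambers G \<phi> B" "vertex us s \<in> D" "vertex vs t \<in> D"
    unfolding complex_edge_def coxeter_complex_def by blast
  then obtain w where "D = range (vertex w)" unfolding chambers_eq by blast
  then have "vertex us s \<in> range (vertex w)" "vertex vs t \<in> range (vertex w)" using D by simp_all
  then obtain s' t' where "vertex us s = vertex w s'" "vertex vs t = vertex w t'" by blast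
  then have "act us (\<omega> s) = act w (\<omega> s)" "act vs (\<omega> t) = act w (\<omega> t)"
    unfolding vertex_eq_iff by blast+
  moreover from this have "s \<noteq> t" using ne by auto
  ultimately show "s \<noteq> t \<and> (\<exists>w. act us (\<omega> s) = act w (\<omega> s) \<and> act vs (\<omega> t) = act w (\<omega> t))" by blast
next
  assume "s \<noteq> t \<and> (\<exists>w. act us (\<omega> s) = act w (\<omega> s) \<and> act vs (\<omega> t) = act w (\<omega> t))"
  then obtain w where w: "s \<noteq> t" "act us (\<omega> s) = act w (\<omega> s)" "act vs (\<omega> t) = act w (\<omega> t)" by blast
  then have "vertex us s \<noteq> vertex vs t" unfolding vertex_eq_iff by blast
  moreover have "{vertex us s, vertex vs t} \<subseteq> range (vertex w)" unfolding w(2,3) by blast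
  moreover have "range (vertex w) \<in> chambers G \<phi> B" unfolding chambers_eq by blast
  ultimately show "complex_edge G \<phi> B (vertex us s) (vertex vs t)"
    unfolding complex_edge_def coxeter_complex_def by blast
qed

lemma real_edge_vertex_iff:
  assumes "0 < \<omega> s $ s" "0 < \<omega> t $ t"
  shows "real_edge G \<phi> B (vertex us s) (vertex vs t) \<longleftrightarrow>
     s \<noteq> t \<and> (\<exists>w. act us (\<omega> s) = act w (\<omega> s) \<and> act vs (\<omega> t) = act w (\<omega> t)) \<and>
     \<omega> s $ t = - sqrt (\<omega> s $ s * \<omega> t $ t)"
proof -
  define N where "N = sqrt (\<omega> s $ s * \<omega> t $ t)"
  have "bf (normalized B (\<omega> s)) (normalized B (\<omega> t)) = \<omega> s $ t / N"
    by (simp add: N_def normalized_def bf_simps bf_weight real_sqrt_mult divide_inverse)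
  moreover have "N > 0" using assms by (simp add: N_def)
  ultimately have "bf (normalized B (\<omega> s)) (normalized B (\<omega> t)) = -1 \<longleftrightarrow> \<omega> s $ t = - N"
    by (simp add: divide_eq_eq)
  then have "bf (normalized B (\<omega> s)) (normalized B (\<omega> t)) = -1 \<longleftrightarrow>
      \<omega> s $ t = - sqrt (\<omega> s $ s * \<omega> t $ t)" by (simp only: N_def)
  then show ?thesis
    using assms unfolding real_edge_def complex_edge_vertex_iff color_vertex spacelike_def bf_weight
    by blast
qed

lemma act_snoc_weight_other: "r \<noteq> s \<Longrightarrow> act (w @ [s]) (\<omega> r) = act w (\<omega> r)"
  using act_weight[of r "[s]"] by (simp add: act_append)

lemma chamber_minus_vertex: "range (vertex w) - {vertex w s} = vertex w ` (- {s})"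
  by (auto simp: vertex_eq_iff)

text \<open>The chambers of \<open>w\<close> and \<open>w @ [s]\<close> share all vertices except
  those of color \<open>\<omega> s\<close>, since \<open>refl s\<close> fixes the other fundamental
  weights.\<close>

lemma surreal_adjacentI:
  assumes s: "\<omega> s $ s = 1" and x: "act us (\<omega> s) = act w (\<omega> s)" "act vs (\<omega> s) = act (w @ [s]) (\<omega> s)"
    and ne: "act us (\<omega> s) \<noteq> act vs (\<omega> s)"
  shows "surreal_adjacent G \<phi> B (vertex us s) (vertex vs s)"
proof -
  let ?D = "range (vertex w)" and ?E = "range (vertex (w @ [s]))"
  let ?F = "vertex w ` (- {s})"
  have u: "vertex us s = vertex w s" and v: "vertex vs s = vertex (w @ [s]) s" using x by simp_all
  have F: "?F = ?D - {vertex w s}" by (simp only: chamber_minus_vertex)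
  have "?F = vertex (w @ [s]) ` (- {s})" using act_snoc_weight_other[of _ s w] by (intro image_cong) auto
  then have F': "?F = ?E - {vertex (w @ [s]) s}" by (simp only: chamber_minus_vertex)
  have "vertex vs s \<notin> ?D"
  proof
    assume "vertex vs s \<in> ?D"
    then obtain r where "vertex vs s = vertex w r" by blast
    then have "act vs (\<omega> s) = act w (\<omega> s)" unfolding vertex_eq_iff by blast
    then show False using ne x by simp
  qed
  moreover have vE: "vertex vs s \<in> ?E" unfolding v by blast
  ultimately have DE: "?D \<noteq> ?E" by blast
  have "color G \<phi> B ` ?F = \<omega> ` (- {s})" by (simp add: image_image color_vertex)
  also have "\<dots> = fundamental_weights B - {\<omega> s}"
    unfolding fundamental_weights_def using inj_weight by (auto dest: injD)
  finally have surr: "surreal_panel G \<phi> B ?F"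
    unfolding surreal_panel_def panel_type_def using s
    by (intro exI[of _ "\<omega> s"]) (auto simp: fundamental_weights_def bf_weight)
  have FD: "panel_of ?F ?D" unfolding panel_of_def using F by blast
  have FE: "panel_of ?F ?E" unfolding panel_of_def using F' by blast
  have uD: "vertex us s \<in> ?D" unfolding u by blast
  have ch: "?D \<in> chambers G \<phi> B" "?E \<in> chambers G \<phi> B" unfolding chambers_eq by blast+
  have "\<exists>D\<in>chambers G \<phi> B. \<exists>E\<in>chambers G \<phi> B. \<exists>F. vertex us s \<in> D \<and> vertex vs s \<in> E \<and>
      D \<noteq> E \<and> panel_of F D \<and> panel_of F E \<and> surreal_panel G \<phi> B F"
    by (rule bexI[OF _ ch(1)], rule bexI[OF _ ch(2)], rule exI[of _ ?F])
      (intro conjI uD vE DE FD FE surr)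
  moreover have "vertex r s \<in> surreal_vertices G \<phi> B" for r
  proof -
    have "vertex r s \<in> vertices G \<phi> B" unfolding vertices_eq by blast
    then show ?thesis by (simp add: surreal_vertices_def color_vertex bf_weight s)
  qed
  moreover have "vertex us s \<noteq> vertex vs s" unfolding vertex_eq_iff using ne by blast
  ultimately show ?thesis unfolding surreal_adjacent_def color_vertex by blast
qed

text \<open>
  An isometry fixing all \<open>\<omega> r\<close> with \<open>r \<noteq> s\<close> moves \<open>\<omega> s\<close> by a multiple of \<open>\<alpha> s\<close>, so it fixes \<open>\<omega> s\<close>
  or maps it to \<open>\<omega> s - 2 \<alpha> s\<close>.
\<close>

lemma surreal_adjacentD:
  assumes adj: "surreal_adjacent G \<phi> B (vertex us s) (vertex vs t)"
  shows "s = t" "\<omega> s $ s = 1" "bf (act us (\<omega> s)) (act vs (\<omega> t)) = -1"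
proof -
  from adj obtain D E F where ne: "vertex us s \<noteq> vertex vs t"
    and surr: "vertex us s \<in> surreal_vertices G \<phi> B" and col: "\<omega> s = \<omega> t"
    and DE: "D \<in> chambers G \<phi> B" "E \<in> chambers G \<phi> B" "vertex us s \<in> D" "vertex vs t \<in> E"
      "panel_of F D" "panel_of F E"
    unfolding surreal_adjacent_def color_vertex by blast
  show st: "s = t" using col inj_weight by (rule injD[rotated])
  show ss: "\<omega> s $ s = 1" using surr by (simp add: surreal_vertices_def color_vertex bf_weight)
  obtain w where D: "D = range (vertex w)" using DE(1) unfolding chambers_eq by blast
  obtain w' where E: "E = range (vertex w')" using DE(2) unfolding chambers_eq by blast
  obtain a where "vertex us s = vertex w a" using DE(3) unfolding D by blast
  then have us: "act us (\<omega> s) = act w (\<omega> s)" unfolding vertex_eq_iff by blast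
  obtain b where "vertex vs t = vertex w' b" using DE(4) unfolding E by blast
  then have vs: "act vs (\<omega> s) = act w' (\<omega> s)" unfolding vertex_eq_iff st by blast
  obtain p where p: "F = D - {vertex w p}" using DE(5) unfolding panel_of_def D by blast
  obtain q where q: "F = E - {vertex w' q}" using DE(6) unfolding panel_of_def E by blast
  have ww: "act w (\<omega> s) \<noteq> act w' (\<omega> s)" using ne us vs st by auto
  have fix_r: "act w (\<omega> r) = act w' (\<omega> r)" if "vertex w r \<in> F" for r
  proof -
    have "vertex w r \<in> range (vertex w')" using that q E by blast
    then obtain r' where "vertex w r = vertex w' r'" by blast
    then show ?thesis unfolding vertex_eq_iff by blast
  qed
  \<comment> \<open>If a vertex of another color were removed, the vertex of color
    \<open>\<omega> s\<close> would lie in the common panel, and \<open>u\<close> and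
    \<open>v\<close> would coincide.\<close>
  have "p = s" using fix_r[of s] ww p D by (auto simp: vertex_eq_iff)
  then have same: "act w (\<omega> r) = act w' (\<omega> r)" if "r \<noteq> s" for r
    using fix_r[of r] p D that by (auto simp: vertex_eq_iff)
  define g where "g = act (rev w @ w')"
  have gr: "g (\<omega> r) = \<omega> r" if "r \<noteq> s" for r
    using same[OF that] act_rev(1)[of w "\<omega> r"] by (simp add: g_def act_append)
  have g_bf: "bf (g x) (g y) = bf x y" for x y unfolding g_def by (rule bf_act)
  define k where "k = (\<omega> s - g (\<omega> s)) $ s"
  have d: "\<omega> s - g (\<omega> s) = k *\<^sub>R \<alpha> s"
  proof (subst vec_eq_iff, rule)
    fix r
    show "(\<omega> s - g (\<omega> s)) $ r = (k *\<^sub>R \<alpha> s) $ r"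
    proof (cases "r = s")
      case True
      then show ?thesis by (simp add: k_def)
    next
      case False
      have "(\<omega> s - g (\<omega> s)) $ r = bf (\<omega> s) (\<omega> r) - bf (g (\<omega> s)) (g (\<omega> r))"
        using gr[OF False] by (simp add: bf_weight)
      also have "\<dots> = 0" unfolding g_bf by simp
      finally show ?thesis using False by (simp add: axis_def)
    qed
  qed
  then have gs: "g (\<omega> s) = \<omega> s - k *\<^sub>R \<alpha> s" by (simp add: algebra_simps)
  have "bf (g (\<omega> s)) (g (\<omega> s)) = \<omega> s $ s - 2 * k + k\<^sup>2"
    unfolding gs by (simp add: bf_simps bf_weight bf_root_weight bf_root_root diag power2_eq_square algebra_simps)
  then have "k * (k - 2) = 0" unfolding g_bf by (simp add: bf_weight power2_eq_square algebra_simps)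
  moreover have "k \<noteq> 0"
  proof
    assume "k = 0"
    then have "act w (g (\<omega> s)) = act w (\<omega> s)" using gs by simp
    then show False using ww by (simp add: g_def act_append act_rev)
  qed
  ultimately have "k = 2" by simp
  have "bf (act us (\<omega> s)) (act vs (\<omega> t)) = bf (act w (\<omega> s)) (act w' (\<omega> s))" using us vs st by simp
  also have "\<dots> = bf (\<omega> s) (g (\<omega> s))" by (simp add: g_def act_append bf_act_left)
  also have "\<dots> = -1" unfolding gs \<open>k = 2\<close> by (simp add: bf_simps bf_weight ss)
  finally show "bf (act us (\<omega> s)) (act vs (\<omega> t)) = -1" .
qed

lemma real_pair:
  assumes s: "0 < \<omega> s $ s" and t: "0 < \<omega> t $ t" and ne: "act us (\<omega> s) \<noteq> act vs (\<omega> t)"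
  defines "x \<equiv> act us (\<omega> s)" and "y \<equiv> act vs (\<omega> t)"
  shows "bf x y \<le> - sqrt (bf x x * bf y y)"
    and "bf x y = - sqrt (bf x x * bf y y) \<longleftrightarrow>
      real_edge G \<phi> B (proj x) (proj y) \<or> surreal_adjacent G \<phi> B (proj x) (proj y)"
proof -
  have xx: "bf x x = \<omega> s $ s" "bf y y = \<omega> t $ t" unfolding x_def y_def by (simp_all only: bf_act_weight_self)
  have "bf x y \<le> - sqrt (bf x x * bf y y) \<and> (bf x y = - sqrt (bf x x * bf y y) \<longleftrightarrow>
      real_edge G \<phi> B (proj x) (proj y) \<or> surreal_adjacent G \<phi> B (proj x) (proj y))"
  proof (cases "s = t")
    case False
    have gram: "\<omega> s $ t \<le> - sqrt (\<omega> s $ s * \<omega> t $ t)" using real_weights_gram[OF s t False] .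
    have nadj: "\<not> surreal_adjacent G \<phi> B (proj x) (proj y)"
      using surreal_adjacentD(1) False unfolding x_def y_def by blast
    note edge = real_edge_vertex_iff[OF s t, of us vs, folded x_def y_def]
    show ?thesis
    proof (rule distinct_color_pairing[of us s vs t, folded x_def y_def])
      fix w assume w: "x = act w (\<omega> s)" "y = act w (\<omega> t)"
      then have "bf x y = \<omega> s $ t" by (simp only: bf_act_weight_self)
      moreover have "real_edge G \<phi> B (proj x) (proj y) \<longleftrightarrow> \<omega> s $ t = - sqrt (\<omega> s $ s * \<omega> t $ t)"
        using edge False w by blast
      ultimately show ?thesis using gram nadj unfolding xx by simp
    next
      assume lt: "bf x y < bf (\<omega> s) (\<omega> t)"
      then have lt': "bf x y < \<omega> s $ t" by (simp only: bf_weight)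
      have "\<not> real_edge G \<phi> B (proj x) (proj y)"
      proof
        assume "real_edge G \<phi> B (proj x) (proj y)"
        then obtain w where w: "x = act w (\<omega> s)" "y = act w (\<omega> t)" using edge by blast
        then have "bf x y = \<omega> s $ t" by (simp only: bf_act_weight_self)
        then show False using lt' by simp
      qed
      then show ?thesis using lt' gram nadj unfolding xx by simp
    qed
  next
    case True
    have y: "y = act vs (\<omega> s)" using True by (simp add: y_def)
    have sq: "sqrt (bf x x * bf y y) = \<omega> s $ s" unfolding xx True using t by simp
    \<comment> \<open>For equal colors the critical value is \<open>- (\<omega> s $ s)\<close>. The
      largest possible product \<open>\<omega> s $ s - 2\<close> reaches it exactly when
      \<open>\<omega> s $ s = 1\<close>, which explains the surreal condition.\<close>
    have le: "\<omega> s $ s - 2 \<le> - (\<omega> s $ s)" using real_weight_le_1[OF s] by simp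
    have nedge: "\<not> real_edge G \<phi> B (proj x) (proj y)"
      using real_edge_vertex_iff[OF s t] True unfolding x_def y_def by blast
    have adjD: "\<omega> s $ s = 1" "bf x y = -1" if "surreal_adjacent G \<phi> B (proj x) (proj y)"
      using surreal_adjacentD[of us s vs t] that unfolding x_def y_def by blast+
    show ?thesis
    proof (rule same_color_pairing[of us s vs, folded x_def y])
      assume "x = y" then show ?thesis using ne unfolding x_def y_def by blast
    next
      fix w assume w: "x = act w (\<omega> s)" "y = act (w @ [s]) (\<omega> s)"
      have "bf x y = \<omega> s $ s - 2"
        unfolding w by (simp add: bf_act act_append refl_eq bf_simps bf_root_weight bf_weight)
      moreover have "surreal_adjacent G \<phi> B (proj x) (proj y)" if "\<omega> s $ s = 1"
        using surreal_adjacentI[OF that, of us w vs, folded x_def y] w ne True unfolding x_def y_def by blast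
      ultimately show ?thesis using le nedge adjD(1) unfolding sq by auto
    next
      assume "bf x y < bf (\<omega> s) (\<omega> s) - 2"
      then have lt: "bf x y < \<omega> s $ s - 2" by (simp only: bf_weight)
      then have "\<not> surreal_adjacent G \<phi> B (proj x) (proj y)" using adjD by auto
      then show ?thesis using lt le nedge unfolding sq by simp
    qed
  qed
  then show "bf x y \<le> - sqrt (bf x x * bf y y)"
    and "bf x y = - sqrt (bf x x * bf y y) \<longleftrightarrow>
      real_edge G \<phi> B (proj x) (proj y) \<or> surreal_adjacent G \<phi> B (proj x) (proj y)" by blast+
qed

lemma real_weight_pair:
  assumes "x \<in> real_weights G \<phi> B" "y \<in> real_weights G \<phi> B" "x \<noteq> y"
  shows "ball_of B c x \<noteq> ball_of B c y"
    and "tangent B (ball_of B c x) (ball_of B c y) \<longleftrightarrow>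
      real_edge G \<phi> B (proj x) (proj y) \<or> surreal_adjacent G \<phi> B (proj x) (proj y)"
proof -
  obtain us s where x: "x = act us (\<omega> s)" "0 < \<omega> s $ s" using assms(1) unfolding real_weights_eq by blast
  obtain vs t where y: "y = act vs (\<omega> t)" "0 < \<omega> t $ t" using assms(2) unfolding real_weights_eq by blast
  have ne: "act us (\<omega> s) \<noteq> act vs (\<omega> t)" using assms(3) x y by simp
  note pair = real_pair[OF x(2) y(2) ne, folded x(1) y(1)]
  have pos: "0 < bf x x" "0 < bf x perron" "0 < bf y y" "0 < bf y perron"
    unfolding x(1) y(1) bf_act_weight_self using x(2) y(2) bf_weight_perron_pos by simp_all
  note ball = ball_pair[OF pos pair(1)]
  show "ball_of B c x \<noteq> ball_of B c y" by (rule ball(2))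
  show "tangent B (ball_of B c x) (ball_of B c y) \<longleftrightarrow>
      real_edge G \<phi> B (proj x) (proj y) \<or> surreal_adjacent G \<phi> B (proj x) (proj y)"
    unfolding ball(3) by (rule pair(2))
qed

theorem tangency_graph:
  "\<exists>f. bij_betw f (real_vertices G \<phi> B) (ball_packing G \<phi> B c) \<and>
    (\<forall>x\<in>real_weights G \<phi> B. proj x \<in> real_vertices G \<phi> B \<and> f (proj x) = ball_of B c x) \<and>
    (\<forall>u\<in>real_vertices G \<phi> B. \<forall>v\<in>real_vertices G \<phi> B. u \<noteq> v \<longrightarrow>
      (tangency_edge B (ball_packing G \<phi> B c) (f u) (f v) \<longleftrightarrow>
         real_edge G \<phi> B u v \<or> surreal_adjacent G \<phi> B u v) \<and>
      (real_edge G \<phi> B u v \<longrightarrow> color G \<phi> B u \<noteq> color G \<phi> B v) \<and>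
      (surreal_adjacent G \<phi> B u v \<longrightarrow> color G \<phi> B u = color G \<phi> B v))"
proof -
  let ?R = "real_weights G \<phi> B"
  \<comment> \<open>Every real vertex is the line of exactly one real weight, so \<open>proj\<close>
    can be inverted on the real weights.\<close>
  define f where "f = (\<lambda>v. ball_of B c (inv_into ?R proj v))"
  have f: "f (proj x) = ball_of B c x" if "x \<in> ?R" for x
    unfolding f_def using inj_on_proj_weights that by simp
  have "inj_on (ball_of B c) ?R" using real_weight_pair(1) by (meson inj_onI)
  moreover have "bij_betw (inv_into ?R proj) (real_vertices G \<phi> B) ?R"
    by (rule bij_betw_inv_into) (simp add: bij_betw_def inj_on_proj_weights proj_real_weights)
  ultimately have bij: "bij_betw f (real_vertices G \<phi> B) (ball_packing G \<phi> B c)"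
    unfolding f_def ball_packing_def
    using bij_betw_trans[of "inv_into ?R proj" "real_vertices G \<phi> B" ?R "ball_of B c" "ball_of B c ` ?R"]
    by (simp add: bij_betw_def comp_def)
  have pair: "(tangency_edge B (ball_packing G \<phi> B c) (f u) (f v) \<longleftrightarrow>
         real_edge G \<phi> B u v \<or> surreal_adjacent G \<phi> B u v) \<and>
      (real_edge G \<phi> B u v \<longrightarrow> color G \<phi> B u \<noteq> color G \<phi> B v) \<and>
      (surreal_adjacent G \<phi> B u v \<longrightarrow> color G \<phi> B u = color G \<phi> B v)"
    if u: "u \<in> real_vertices G \<phi> B" and v: "v \<in> real_vertices G \<phi> B" and uv: "u \<noteq> v" for u v
  proof (intro conjI impI)
    obtain us s where us: "u = vertex us s" "0 < \<omega> s $ s" using u unfolding real_vertices_eq by blast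
    obtain vs t where vs: "v = vertex vs t" "0 < \<omega> t $ t" using v unfolding real_vertices_eq by blast
    have R: "act us (\<omega> s) \<in> ?R" "act vs (\<omega> t) \<in> ?R" unfolding real_weights_eq using us vs by blast+
    have ne: "act us (\<omega> s) \<noteq> act vs (\<omega> t)" using uv us vs by auto
    show "tangency_edge B (ball_packing G \<phi> B c) (f u) (f v) \<longleftrightarrow>
         real_edge G \<phi> B u v \<or> surreal_adjacent G \<phi> B u v"
      using real_weight_pair[OF R ne] R unfolding us(1) vs(1) f[OF R(1)] f[OF R(2)] tangency_edge_def ball_packing_def
      by blast
    show "color G \<phi> B u \<noteq> color G \<phi> B v" if "real_edge G \<phi> B u v"
    proof -
      have "s \<noteq> t" using that real_edge_vertex_iff[OF us(2) vs(2)] unfolding us(1) vs(1) by blast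
      then show ?thesis unfolding us(1) vs(1) color_vertex using inj_weight by (auto dest: injD)
    qed
    show "color G \<phi> B u = color G \<phi> B v" if "surreal_adjacent G \<phi> B u v"
      using that unfolding surreal_adjacent_def by blast
  qed
  show ?thesis
  proof (intro exI[of _ f] conjI ballI impI)
    fix x assume "x \<in> ?R"
    then show "proj x \<in> real_vertices G \<phi> B" "f (proj x) = ball_of B c x"
      using f proj_real_weights by blast+
  qed (use bij pair in blast)+
qed

end

section \<open>From Coxeter systems to the form\<close>

lemma coxeter_form_geometric:
  assumes "coxeter_matrix m" "geometric_matrix m B"
  shows "coxeter_form B"
proof
  fix s t
  have g: "case m s t of enat k \<Rightarrow> B$s$t = - cos (pi / real k) | \<infinity> \<Rightarrow> B$s$t = B$t$s \<and> B$s$t \<le> -1" for s t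
    using assms(2) unfolding geometric_matrix_def by blast
  have msym: "m s t = m t s" using assms(1) unfolding coxeter_matrix_def by blast
  have "m s s = enat 1" using assms(1) unfolding coxeter_matrix_def one_enat_def by blast
  then show "B$s$s = 1" using g[of s s] by simp
  show "B$s$t = B$t$s"
  proof (cases "m s t")
    case (enat k)
    then have "m t s = enat k" using msym by simp
    then show ?thesis using g[of s t] g[of t s] enat by simp
  next
    case infinity
    then show ?thesis using g[of s t] by simp
  qed
  show "B$s$t \<le> 0" if "s \<noteq> t"
  proof (cases "m s t")
    case (enat k)
    have "2 \<le> m s t" using assms(1) that unfolding coxeter_matrix_def by blast
    then have "2 \<le> k" unfolding enat by (simp add: numeral_eq_enat)
    then have "0 \<le> pi / real k" "pi / real k \<le> pi / 2" by (simp_all add: field_simps)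
    then have "0 \<le> cos (pi / real k)" using pi_gt_zero by (intro cos_ge_zero) linarith+
    then show ?thesis using g[of s t] enat by simp
  next
    case infinity
    then show ?thesis using g[of s t] by simp
  qed
qed

lemma connected_geometric:
  assumes "coxeter_matrix m" "irreducible_coxeter m" "geometric_matrix m B"
  shows "(\<lambda>a b. B$a$b < 0)\<^sup>*\<^sup>* s t"
proof -
  have "(\<lambda>a b. a \<noteq> b \<and> 3 \<le> m a b)\<^sup>*\<^sup>* s t" using assms(2) unfolding irreducible_coxeter_def by blast
  moreover have "B$a$b < 0" if "a \<noteq> b \<and> 3 \<le> m a b" for a b
  proof -
    have g: "case m a b of enat k \<Rightarrow> B$a$b = - cos (pi / real k) | \<infinity> \<Rightarrow> B$a$b = B$b$a \<and> B$a$b \<le> -1"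
      using assms(3) unfolding geometric_matrix_def by blast
    show ?thesis
    proof (cases "m a b")
      case (enat k)
      then have "3 \<le> k" using that by (simp add: numeral_eq_enat)
      then have "pi / real k < pi / 2" "0 < pi / real k" by (simp_all add: field_simps)
      then have "0 < cos (pi / real k)" by (intro cos_gt_zero) simp_all
      then show ?thesis using g enat by simp
    next
      case infinity
      then show ?thesis using g by simp
    qed
  qed
  ultimately show ?thesis
    using mono_rtranclp[of "\<lambda>a b. a \<noteq> b \<and> 3 \<le> m a b" "\<lambda>a b. B$a$b < 0" s t] by simp
qed

lemma sum_principal:
  fixes B :: "real^'s::finite^'s"
  assumes "\<And>i. i \<notin> I \<Longrightarrow> x i = 0"
  shows "(\<Sum>i\<in>I. \<Sum>j\<in>I. x i * B$i$j * x j) = (\<Sum>i\<in>UNIV. \<Sum>j\<in>UNIV. x i * B$i$j * x j)"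
proof -
  have "(\<Sum>i\<in>I. \<Sum>j\<in>I. x i * B$i$j * x j) = (\<Sum>i\<in>I. \<Sum>j\<in>UNIV. x i * B$i$j * x j)"
    using assms by (intro sum.cong refl sum.mono_neutral_left) auto
  also have "\<dots> = (\<Sum>i\<in>UNIV. \<Sum>j\<in>UNIV. x i * B$i$j * x j)"
    using assms by (intro sum.mono_neutral_left) auto
  finally show ?thesis .
qed

context coxeter_form
begin

text \<open>Principal submatrices are restrictions of the form to vectors supported on the index
  set. Level at most two thus speaks about complements of pairs, and failure of level one supplies a
  negative vector.\<close>

lemma level_two_form_has_level:
  assumes level: "has_level B 2" and conn: "\<And>s t. (\<lambda>a b. B$a$b < 0)\<^sup>*\<^sup>* s t"
  shows "level_two_form B"
proof
  have le2: "level_le B 2" and nle: "\<not> level_le B 1"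
    using level unfolding has_level_def by simp_all
  obtain I x where I: "card I = CARD('s) - 1" and neg: "(\<Sum>i\<in>I. \<Sum>j\<in>I. x i * B$i$j * x j) < 0"
    using nle unfolding level_le_def principal_psd_def by (auto simp: not_le)
  define y where "y = (\<chi> i. if i \<in> I then x i else 0)"
  have "(\<Sum>i\<in>I. \<Sum>j\<in>I. x i * B$i$j * x j) = (\<Sum>i\<in>I. \<Sum>j\<in>I. y$i * B$i$j * y$j)"
    by (intro sum.cong refl) (simp add: y_def)
  also have "\<dots> = bf y y"
    unfolding bf_sum by (rule sum_principal) (simp add: y_def)
  finally show "\<exists>x. bf x x < 0" using neg by auto
  show "0 \<le> bf x x" if "s \<noteq> t" "x$s = 0" "x$t = 0" for s t x
  proof -
    have "card (- {s,t}) = CARD('s) - 2"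
      using that(1) by (simp add: Compl_eq_Diff_UNIV card_Diff_subset)
    then have "principal_psd B (- {s,t})" using le2 unfolding level_le_def by blast
    then have "0 \<le> (\<Sum>i\<in>-{s,t}. \<Sum>j\<in>-{s,t}. x$i * B$i$j * x$j)"
      unfolding principal_psd_def by blast
    also have "\<dots> = bf x x"
      unfolding bf_sum by (rule sum_principal) (use that in auto)
    finally show ?thesis .
  qed
  show "3 \<le> CARD('s)"
  \<comment> \<open>In rank at most two the set \<open>I\<close> has at most one element, and its
    principal form is zero or a square.\<close>
  proof (rule ccontr)
    assume "\<not> 3 \<le> CARD('s)"
    then have "card I \<le> 1" using I by simp
    then have "I = {} \<or> (\<exists>i. I = {i})"
      by (metis One_nat_def card_0_eq card_1_singletonE finite le_Suc_eq le_zero_eq)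
    then have "0 \<le> (\<Sum>i\<in>I. \<Sum>j\<in>I. x i * B$i$j * x j)" by (auto simp: diag)
    then show False using neg by simp
  qed
qed (rule conn)

section \<open>Transfer from the abstract Coxeter group to words of reflections\<close>

context
  fixes G :: "('g, 'b) monoid_scheme" and gen :: "'s \<Rightarrow> 'g" and \<phi> :: "'g \<Rightarrow> real^'s \<Rightarrow> real^'s" and m
  assumes sys: "coxeter_system G gen m" and action: "geometric_action G gen B \<phi>"
begin

lemma coxeter_systemD:
  "coxeter_matrix m" "group G" "range gen \<subseteq> carrier G" "generate G (range gen) = carrier G"
  "equivclp (coxeter_step m) xs ys \<Longrightarrow> word_value G gen xs = word_value G gen ys"
  using sys by (simp_all add: coxeter_system_def)

lemma gen_carrier: "gen s \<in> carrier G"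
  using coxeter_systemD(3) by blast

lemma word_value_carrier: "word_value G gen xs \<in> carrier G"
proof -
  interpret group G by (rule coxeter_systemD(2))
  show ?thesis by (induction xs) (auto simp: word_value_def gen_carrier)
qed

lemma action_mult: "g \<in> carrier G \<Longrightarrow> h \<in> carrier G \<Longrightarrow> \<phi> (g \<otimes>\<^bsub>G\<^esub> h) x = \<phi> g (\<phi> h x)"
  using action group_action.composition_rule[of G UNIV \<phi> x g h] unfolding geometric_action_def by blast

lemma action_one: "\<phi> \<one>\<^bsub>G\<^esub> x = x"
  using action group_action.id_eq_one[of G UNIV \<phi>] unfolding geometric_action_def
  by (metis UNIV_I restrict_apply')

lemma action_gen: "\<phi> (gen s) = refl s"
  using action unfolding geometric_action_def by blast

lemma action_word: "\<phi> (word_value G gen xs) = act xs"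
proof (induction xs)
  case Nil
  show ?case by (auto simp: fun_eq_iff word_value_def action_one)
next
  case (Cons s xs)
  have "word_value G gen (s # xs) = gen s \<otimes>\<^bsub>G\<^esub> word_value G gen xs" by (simp add: word_value_def)
  then show ?case
    using Cons by (simp add: fun_eq_iff action_mult gen_carrier word_value_carrier action_gen)
qed

lemma coxeter_relation:
  assumes "m s t = enat k"
  shows "word_value G gen (concat (replicate k [s,t])) = \<one>\<^bsub>G\<^esub>"
proof -
  have "coxeter_step m (concat (replicate k [s,t])) []"
    unfolding coxeter_step_def using assms by (intro exI[of _ "[]"] exI[of _ s] exI[of _ t] exI[of _ k]) simp
  then have "equivclp (coxeter_step m) (concat (replicate k [s,t])) []" by (rule r_into_equivclp)
  then have "word_value G gen (concat (replicate k [s,t])) = word_value G gen []"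
    by (rule coxeter_systemD(5))
  then show ?thesis by (simp add: word_value_def)
qed

lemma action_range: "\<phi> ` carrier G = range act"
proof (intro equalityI subsetI)
  interpret group G by (rule coxeter_systemD(2))
  have inv_gen: "inv\<^bsub>G\<^esub> (gen s) = gen s" for s
  proof -
    have "m s s = enat 1" using coxeter_systemD(1) unfolding coxeter_matrix_def one_enat_def by blast
    then have "gen s \<otimes>\<^bsub>G\<^esub> gen s = \<one>\<^bsub>G\<^esub>"
      using coxeter_relation[of s s 1] by (simp add: word_value_def gen_carrier)
    then show ?thesis by (intro inv_equality gen_carrier)
  qed
  have ex: "\<exists>xs. \<phi> g = act xs" if "g \<in> generate G (range gen)" for g
    using that
  proof induction
    case one
    show ?case by (rule exI[of _ "[]"]) (auto simp: fun_eq_iff action_one)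
  next
    case (incl h)
    then obtain s where "h = gen s" by blast
    then show ?case by (intro exI[of _ "[s]"]) (auto simp: fun_eq_iff action_gen)
  next
    case (inv h)
    then obtain s where "h = gen s" by blast
    then show ?case by (intro exI[of _ "[s]"]) (auto simp: fun_eq_iff action_gen inv_gen)
  next
    case (eng g h)
    obtain xs ys where "\<phi> g = act xs" "\<phi> h = act ys" using eng.IH by blast
    moreover have "g \<in> carrier G" "h \<in> carrier G"
      using eng.hyps unfolding coxeter_systemD(4) by blast+
    ultimately show ?case by (intro exI[of _ "xs @ ys"]) (auto simp: fun_eq_iff action_mult act_append)
  qed
  fix f assume "f \<in> \<phi> ` carrier G"
  then obtain g where g: "g \<in> carrier G" "f = \<phi> g" by blast
  then have "g \<in> generate G (range gen)" unfolding coxeter_systemD(4) by simp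
  from ex[OF this] show "f \<in> range act" unfolding g(2) by blast
next
  fix f assume "f \<in> range act"
  then obtain xs where "f = act xs" by blast
  then show "f \<in> \<phi> ` carrier G" using action_word[of xs] word_value_carrier[of xs] by (metis imageI)
qed

lemma act_braid:
  assumes "m s t = enat k" shows "act (concat (replicate k [s,t])) x = x"
proof -
  have "act (concat (replicate k [s,t])) x = \<phi> (word_value G gen (concat (replicate k [s,t]))) x"
    by (simp only: action_word)
  then show ?thesis by (simp only: coxeter_relation[OF assms] action_one)
qed

end

end

theorem theorem3p9:
  fixes G :: "('g, 'b) monoid_scheme" and gen :: "'s::finite \<Rightarrow> 'g"
    and m :: "'s \<Rightarrow> 's \<Rightarrow> enat" and B :: "real^'s^'s"
    and \<phi> :: "'g \<Rightarrow> real^'s \<Rightarrow> real^'s" and c :: "real^'s"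
  assumes "coxeter_system G gen m"
    and "irreducible_coxeter m"
    and "geometric_matrix m B"
    and "geometric_action G gen B \<phi>"
    and "has_level B 2"
    and "height_form B c"
  shows "\<exists>f. bij_betw f (real_vertices G \<phi> B) (ball_packing G \<phi> B c) \<and>
    (\<forall>x\<in>real_weights G \<phi> B. proj x \<in> real_vertices G \<phi> B \<and> f (proj x) = ball_of B c x) \<and>
    (\<forall>u\<in>real_vertices G \<phi> B. \<forall>v\<in>real_vertices G \<phi> B. u \<noteq> v \<longrightarrow>
      (tangency_edge B (ball_packing G \<phi> B c) (f u) (f v) \<longleftrightarrow>
         real_edge G \<phi> B u v \<or> surreal_adjacent G \<phi> B u v) \<and>
      (real_edge G \<phi> B u v \<longrightarrow> color G \<phi> B u \<noteq> color G \<phi> B v) \<and>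
      (surreal_adjacent G \<phi> B u v \<longrightarrow> color G \<phi> B u = color G \<phi> B v))"
proof -
  have matrix: "coxeter_matrix m" using assms(1) unfolding coxeter_system_def by blast
  interpret coxeter_form B using matrix assms(3) by (rule coxeter_form_geometric)
  have level: "level_two_form B"
    using assms(5) connected_geometric[OF matrix assms(2,3)] by (rule level_two_form_has_level)
  have refl: "coxeter_reflections B m"
  proof
    fix s t :: 's and k and x :: "real^'s"
    have g: "case m s t of enat k \<Rightarrow> B$s$t = - cos (pi / real k) | \<infinity> \<Rightarrow> B$s$t = B$t$s \<and> B$s$t \<le> -1"
      using assms(3) unfolding geometric_matrix_def by blast
    show "m s t = m t s" using matrix unfolding coxeter_matrix_def by blast
    show "s \<noteq> t \<Longrightarrow> 2 \<le> m s t" using matrix unfolding coxeter_matrix_def by blast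
    show "m s t = enat k \<Longrightarrow> B$s$t = - cos (pi / real k)" using g by simp
    show "m s t = \<infinity> \<Longrightarrow> B$s$t \<le> -1" using g by simp
    show "m s t = enat k \<Longrightarrow> act (concat (replicate k [s,t])) x = x"
      by (rule act_braid[OF assms(1,4)])
  qed
  \<comment> \<open>In either case of \<open>height_form\<close> the coefficients are positive: the
    default form is the all-ones vector.\<close>
  have c: "0 < c $ s" "avoids_light_cone B c" for s
    using assms(6) unfolding height_form_def by (auto split: if_splits)
  have "coxeter_packing B m c G \<phi>"
    unfolding coxeter_packing_def coxeter_packing_axioms_def level_two_coxeter_def level_two_balls_def
      level_two_balls_axioms_def
    using level refl c action_range[OF assms(1,4)] by blast
  then show ?thesis by (rule coxeter_packing.tangency_graph)
qed

end
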